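(* Let $G$ be a finite simple graph and $d\geq 2$. Let $B$ be a set of vertices of $G$ such that the induced subgraph $H=G|_B$ is $d$-heavy. Let $\sigma,\pi$ be set partitions of $V(G)$ such that $\sigma$ refines $\pi$ and $B\in\pi\setminus\sigma$ (i.e., $B$ is a block of $\pi$ but not of $\sigma$). Then $\mathcal{X}^d_\pi(G)\not\subset\overline{\mathcal{X}^d_\sigma(G)}$, i.e., $\mathcal{X}^d_\pi(G)$ is not contained in $\overline{\mathcal{X}^d_\sigma(G)}$.
   Context: Let $\mathbb{F}$ be an algebraically closed field and $\mathbb{P}^d$ the projective $d$-space over $\mathbb{F}$. Let $G$ be a finite simple graph with vertex set $V$ and edge set $E$. A picture $P$ of $G$ in $\mathbb{P}^d$ consists of a point $P(v)\in\mathbb{P}^d$ for each vertex $v$ and a line $P(e)\subseteq\mathbb{P}^d$ for each edge $e$, such that $P(v)\in P(e)$ whenever $v$ is an endpoint of $e$. The picture space $\mathcal{X}^d(G)$ is the set of all pictures of $G$, regarded as a Zariski-closed (reduced) algebraic subset of the product of $|V|$ copies of $\mathbb{P}^d$ and $|E|$ copies of the Grassmannian of lines in $\mathbb{P}^d$. For a set partition $\pi$ of $V$, write $v\sim_\pi w$ if $v,w$ lie in the same block of $\pi$. The cellule of $\pi$ is $\mathcal{X}^d_\pi(G)=\{P\in\mathcal{X}^d(G) : P(v)=P(w)\iff v\sim_\pi w\}$. The bar denotes Zariski closure in $\mathcal{X}^d(G)$. A partition $\sigma$ refines $\pi$ if every block of $\sigma$ is contained in some block of $\pi$. The indiscrete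 cellule $\mathcal{X}^d_I(H)$ of a graph $H$ is the cellule of the partition of $V(H)$ with only one block. A graph $H$ is called $d$-heavy if $\mathcal{X}^d_I(H)$ has maximum dimension (not necessarily uniquely) among all cellules of $\mathcal{X}^d(H)$. *)

theory Defs
  imports
    "HOL-Analysis.Analysis"
    "HOL-Library.Disjoint_Sets"
    "HOL-Library.Poly_Mapping"
    "HOL-Computational_Algebra.Polynomial"
begin

section \<open>Dimension of a topological space\<close>

definition irreducible_in :: "'a topology \<Rightarrow> 'a set \<Rightarrow> bool" where
  "irreducible_in T S \<longleftrightarrow> S \<subseteq> topspace T \<and> S \<noteq> {} \<and>
     (\<forall>A B. closedin T A \<longrightarrow> closedin T B \<longrightarrow> S \<subseteq> A \<union> B \<longrightarrow> S \<subseteq> A \<or> S \<subseteq> B)"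

text \<open>The supremum of the lengths \<open>n\<close> of chains \<open>Z 0 \<subset> \<dots> \<subset> Z n\<close> of irreducible closed subsets.
  The value is an extended real so that the empty space has dimension \<open>-\<infinity>\<close>.\<close>

definition krull_dim :: "'a topology \<Rightarrow> ereal" where
  "krull_dim T = Sup {ereal (real n) | n. \<exists>Z :: nat \<Rightarrow> 'a set.
     (\<forall>i\<le>n. closedin T (Z i) \<and> irreducible_in T (Z i)) \<and> (\<forall>i<n. Z i \<subset> Z (Suc i))}"


section \<open>Graphs\<close>

definition simple_graph :: "'v set \<Rightarrow> 'v set set \<Rightarrow> bool" where
  "simple_graph V E \<longleftrightarrow> finite V \<and> (\<forall>e\<in>E. e \<subseteq> V \<and> card e = 2)"

definition induced_edges :: "'v set set \<Rightarrow> 'v set \<Rightarrow> 'v set set" where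
  "induced_edges E B = {e \<in> E. e \<subseteq> B}"


section \<open>Pictures\<close>

text \<open>The projective space of dimension \<open>CARD('n) - 1\<close> over \<open>'a\<close>: its points and lines are the linear
  subspaces of \<open>'a ^ 'n\<close> of dimension 1 and 2, and incidence is inclusion.\<close>

definition proj_points :: "('a::field ^ 'n) set set" where
  "proj_points = {U. vec.subspace U \<and> vec.dim U = 1}"

definition proj_lines :: "('a::field ^ 'n) set set" where
  "proj_lines = {U. vec.subspace U \<and> vec.dim U = 2}"

type_synonym ('a, 'n, 'v) picture = "('v \<Rightarrow> ('a ^ 'n) set) \<times> ('v set \<Rightarrow> ('a ^ 'n) set)"

definition ambient_space :: "'v set \<Rightarrow> 'v set set \<Rightarrow> ('a::field, 'n::finite, 'v) picture set" where
  "ambient_space V E = (V \<rightarrow>\<^sub>E proj_points) \<times> (E \<rightarrow>\<^sub>E proj_lines)"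

definition picture_space :: "'v set \<Rightarrow> 'v set set \<Rightarrow> ('a::field, 'n::finite, 'v) picture set" where
  "picture_space V E = {P \<in> ambient_space V E. \<forall>e\<in>E. \<forall>v\<in>e. fst P v \<subseteq> snd P e}"


section \<open>The Zariski topology\<close>

text \<open>Homogeneous coordinates of the points, and Pluecker coordinates of the lines.\<close>

datatype ('n, 'v) coord = PointCoord 'v 'n | LineCoord "'v set" 'n 'n

type_synonym ('a, 'n, 'v) picture_poly = "(('n, 'v) coord \<Rightarrow>\<^sub>0 nat) \<Rightarrow>\<^sub>0 'a"

definition poly_eval :: "('x \<Rightarrow> 'a::comm_ring_1) \<Rightarrow> (('x \<Rightarrow>\<^sub>0 nat) \<Rightarrow>\<^sub>0 'a) \<Rightarrow> 'a" where
  "poly_eval c p = (\<Sum>m\<in>Poly_Mapping.keys p. Poly_Mapping.lookup p m *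
     (\<Prod>x\<in>Poly_Mapping.keys m. c x ^ Poly_Mapping.lookup m x))"

text \<open>Homogeneous separately in the coordinates of each vertex \<open>v \<in> V\<close> (of degree \<open>a v\<close>) and of each
  edge \<open>e \<in> E\<close> (of degree \<open>b e\<close>), and involving no other variables.\<close>

definition multihomogeneous ::
    "'v set \<Rightarrow> 'v set set \<Rightarrow> ('a::field, 'n::finite, 'v) picture_poly \<Rightarrow> bool" where
  "multihomogeneous V E p \<longleftrightarrow> (\<exists>a b. (\<forall>v. v \<notin> V \<longrightarrow> a v = 0) \<and> (\<forall>e. e \<notin> E \<longrightarrow> b e = 0) \<and>
     (\<forall>m\<in>Poly_Mapping.keys p.
        (\<forall>v. (\<Sum>i\<in>UNIV. Poly_Mapping.lookup m (PointCoord v i)) = a v) \<and>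
        (\<forall>e. (\<Sum>i\<in>UNIV. \<Sum>j\<in>UNIV. Poly_Mapping.lookup m (LineCoord e i j)) = b e)))"

text \<open>\<open>c\<close> is a choice of coordinates of \<open>P\<close>; each point and each line determines its own coordinates only
  up to a nonzero scalar.\<close>

definition coordinates_of :: "'v set \<Rightarrow> 'v set set \<Rightarrow> ('a::field, 'n::finite, 'v) picture \<Rightarrow>
    (('n, 'v) coord \<Rightarrow> 'a) \<Rightarrow> bool" where
  "coordinates_of V E P c \<longleftrightarrow>
     (\<forall>v\<in>V. \<exists>x. vec.span {x} = fst P v \<and> (\<forall>i. c (PointCoord v i) = x $ i)) \<and>
     (\<forall>e\<in>E. \<exists>x y. vec.span {x, y} = snd P e \<and>
        (\<forall>i j. c (LineCoord e i j) = x $ i * y $ j - x $ j * y $ i))"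

text \<open>Whether a multihomogeneous polynomial vanishes does not depend on the choice of coordinates.\<close>

definition zero_locus :: "'v set \<Rightarrow> 'v set set \<Rightarrow> ('a::field, 'n::finite, 'v) picture_poly \<Rightarrow>
    ('a, 'n, 'v) picture set" where
  "zero_locus V E p = {P \<in> ambient_space V E. \<forall>c. coordinates_of V E P c \<longrightarrow> poly_eval c p = 0}"

text \<open>The complements of the zero loci form a base, because the union of two zero loci is the zero locus of
  the product; hence the closed sets are exactly the common zero loci of sets of multihomogeneous
  polynomials.\<close>

definition zariski_topology ::
    "'v set \<Rightarrow> 'v set set \<Rightarrow> ('a::field, 'n::finite, 'v) picture topology" where
  "zariski_topology V E =
     topology_generated_by {ambient_space V E - zero_locus V E p | p. multihomogeneous V E p}"

definition picture_topology ::
    "'v set \<Rightarrow> 'v set set \<Rightarrow> ('a::field, 'n::finite, 'v) picture topology" where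
  "picture_topology V E = subtopology (zariski_topology V E) (picture_space V E)"


section \<open>Cellules and heavy graphs\<close>

definition cellule ::
    "'v set \<Rightarrow> 'v set set \<Rightarrow> 'v set set \<Rightarrow> ('a::field, 'n::finite, 'v) picture set" where
  "cellule V E \<pi> = {P \<in> picture_space V E.
     \<forall>v\<in>V. \<forall>w\<in>V. fst P v = fst P w \<longleftrightarrow> (\<exists>A\<in>\<pi>. v \<in> A \<and> w \<in> A)}"

definition cellule_dim ::
    "('a::field ^ 'n::finite) itself \<Rightarrow> 'v set \<Rightarrow> 'v set set \<Rightarrow> 'v set set \<Rightarrow> ereal" where
  "cellule_dim _ V E \<pi> =
     krull_dim (subtopology (picture_topology V E) (cellule V E \<pi> :: ('a, 'n, 'v) picture set))"

text \<open>The first argument fixes the field and the projective space: \<open>d_heavy TYPE('a ^ 'n)\<close> means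
  \<open>d\<close>-heavy over \<open>'a\<close> for \<open>d = CARD('n) - 1\<close>.\<close>

definition d_heavy :: "('a::field ^ 'n::finite) itself \<Rightarrow> 'v set \<Rightarrow> 'v set set \<Rightarrow> bool" where
  "d_heavy F V E \<longleftrightarrow> (\<forall>\<tau>. partition_on V \<tau> \<longrightarrow> cellule_dim F V E \<tau> \<le> cellule_dim F V E {V})"

end

theory Submission
  imports Defs
begin

text \<open>Restricting pictures to \<open>B\<close> reduces the claim to \<open>H\<close>: if \<open>\<tau>\<close> is a partition of \<open>B\<close> with at least
  two blocks, then some multihomogeneous polynomial vanishes on the cellule of \<open>\<tau>\<close> but not on the indiscrete one.

  The cellule of \<open>\<tau>\<close> is a finite union of charts, each of them the image of an open subset of an affine
  space of one and the same dimension \<open>N\<close>. Fixing the parameters of a chart one at a time gives a chain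
  showing that the cellule has dimension at least \<open>N\<close>, so by heaviness there is a chain
  \<open>Z 0 \<subset> \<dots> \<subset> Z n\<close> of irreducible closed subsets of the indiscrete cellule with \<open>n \<ge> N\<close>. If the
  indiscrete cellule were contained in the closure of the cellule of \<open>\<tau>\<close>, then by irreducibility \<open>Z n\<close> would be
  contained in the closure of a single chart \<open>W\<close>, and \<open>W\<close> would prolong the chain. Polynomials that vanish on one
  member of a chain but not on the next are algebraically independent on the last member, so
  there would be \<open>n + 1 > N\<close> algebraically independent functions on \<open>W\<close>. This is impossible, since \<open>W\<close> is
  parametrized polynomially by \<open>N\<close> variables (count monomials).\<close>

section \<open>Polynomial functions\<close>

text \<open>Heaviness is only a weak inequality of dimensions; the contradiction comes from the one
  extra step of the prolonged chain. That step is strict because \<tau> has two blocks: the minors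
  of the points of two vertices from different blocks vanish on the indiscrete cellule, but not all
  of them vanish on a chart.

  All charts have equally many parameters: a block contributes \<open>CARD('n) - 1\<close>, an edge
  inside a block \<open>CARD('n) - 2\<close>, an edge between blocks none, whichever coordinates are
  normalized.

  The obstacle is homogeneity: a linear combination of monomials in multihomogeneous polynomials
  defines a locus only if its terms have equal multidegree. So one picture \<open>P\<close> is fixed
  in \<open>Z 0\<close>, and the polynomials separating the chain are multiplied by monomials
  nonzero at \<open>P\<close> until all have one common degree. As \<open>P\<close> lies in the
  smallest member, these factors vanish identically on no member, and by irreducibility the products
  still separate.

  The reduction to \<open>H\<close> is asymmetric: pictures in the cellule of \<sigma> are
  restricted to \<open>B\<close>, while one picture of the indiscrete cellule of \<open>H\<close>
  must be extended to \<open>G\<close>.\<close>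

lemma infinite_UNIV_alg_closed_field: "infinite (UNIV :: 'a::alg_closed_field set)"
proof
  assume fin: "finite (UNIV :: 'a set)"
  \<comment> \<open>\<open>p\<close> vanishes at every element of the field, so \<open>p + 1\<close>
    is a nonconstant polynomial without a root.\<close>
  define p :: "'a poly" where "p = (\<Prod>a\<in>UNIV. [:-a, 1:])"
  have nz: "[:-a, 1:] \<noteq> 0" for a :: 'a
    by simp
  have "degree p = (\<Sum>a\<in>(UNIV::'a set). degree [:-a, 1:])"
    unfolding p_def by (rule degree_prod_sum_eq) (simp add: nz)
  then have "degree p > 0"
    using fin by (simp add: card_gt_0_iff)
  then have "degree (p + 1) > 0"
    by (metis add.commute degree_1 degree_add_eq_right)
  then obtain z where "poly (p + 1) z = 0"
    using alg_closed_imp_poly_has_root by blast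
  moreover have "poly p z = 0"
    unfolding p_def poly_prod using fin by (intro prod_zero) auto
  ultimately show False
    by simp
qed

text \<open>Elimination: an equation \<open>b\<close> with a nonzero coefficient at some
  \<open>a0\<close> is solved for the unknown \<open>c a0\<close> and substituted into the others,
  which removes one equation and one unknown.\<close>

lemma homogeneous_system_has_nontrivial_solution:
  fixes m :: "'i \<Rightarrow> 'j \<Rightarrow> 'a::field"
  assumes "finite B" "finite A" "card B < card A"
  shows "\<exists>c. (\<exists>a\<in>A. c a \<noteq> 0) \<and> (\<forall>b\<in>B. (\<Sum>a\<in>A. c a * m a b) = 0)"
  using assms
proof (induction B arbitrary: A m rule: finite_induct)
  case empty
  then have "A \<noteq> {}" by auto
  then show ?case by (intro exI[of _ "\<lambda>_. 1"]) auto
next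
  case (insert b B)
  show ?case
  proof (cases "\<forall>a\<in>A. m a b = 0")
    case True
    obtain c where "\<exists>a\<in>A. c a \<noteq> 0" "\<forall>b\<in>B. (\<Sum>a\<in>A. c a * m a b) = 0"
      using insert.IH[of A m] insert.prems insert.hyps by auto
    then show ?thesis using True by (intro exI[of _ c]) auto
  next
    case False
    then obtain a0 where a0: "a0 \<in> A" "m a0 b \<noteq> 0" by blast
    define A' where "A' = A - {a0}"
    have A': "A = insert a0 A'" "a0 \<notin> A'" "finite A'"
      using a0 insert.prems by (auto simp: A'_def)
    define m' where "m' = (\<lambda>a b'. m a b' - m a b / m a0 b * m a0 b')"
    have "card B < card A'"
      using insert A' by auto
    then obtain c where c: "\<exists>a\<in>A'. c a \<noteq> 0" "\<forall>b\<in>B. (\<Sum>a\<in>A'. c a * m' a b) = 0"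
      using insert.IH[of A' m'] A' by auto
    \<comment> \<open>The value that equation \<open>b\<close> forces on the unknown
      \<open>a0\<close>.\<close>
    define s where "s = - (\<Sum>a\<in>A'. c a * m a b / m a0 b)"
    define c' where "c' = c(a0 := s)"
    have sum_c': "(\<Sum>a\<in>A. c' a * m a b') = s * m a0 b' + (\<Sum>a\<in>A'. c a * m a b')" for b'
    proof -
      have "(\<Sum>a\<in>A'. c' a * m a b') = (\<Sum>a\<in>A'. c a * m a b')"
        using A' by (intro sum.cong) (auto simp: c'_def)
      then show ?thesis using A' by (simp add: c'_def)
    qed
    have "(\<Sum>a\<in>A. c' a * m a b') = 0" if "b' \<in> insert b B" for b'
    proof (cases "b' = b")
      case True
      have "s * m a0 b = - (\<Sum>a\<in>A'. c a * m a b)"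
        using a0 by (simp add: s_def sum_distrib_right)
      then show ?thesis using True sum_c' by simp
    next
      case False
      then have "(\<Sum>a\<in>A'. c a * m' a b') = 0"
        using c that by auto
      then show ?thesis
        unfolding sum_c' s_def m'_def
        by (simp add: sum_distrib_left sum_subtractf algebra_simps)
    qed
    moreover have "\<exists>a\<in>A. c' a \<noteq> 0"
      using c A' by (auto simp: c'_def)
    ultimately show ?thesis by blast
  qed
qed

text \<open>\<open>K\<close> bounds the degree in each variable separately, so that for finite
  \<open>J\<close> there are exactly \<open>(K + 1) ^ card J\<close> monomials. Functions are used
  instead of formal polynomials because only linear relations between values and restrictions to
  lines matter.\<close>

inductive_set poly_funs :: "'x set \<Rightarrow> nat \<Rightarrow> (('x \<Rightarrow> 'a::comm_ring_1) \<Rightarrow> 'a) set"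
  for J :: "'x set" and K :: nat where
  zero: "(\<lambda>t. 0) \<in> poly_funs J K"
| monom_add: "f \<in> poly_funs J K \<Longrightarrow> \<forall>j\<in>J. \<beta> j \<le> K \<Longrightarrow>
    (\<lambda>t. c * (\<Prod>j\<in>J. t j ^ \<beta> j) + f t) \<in> poly_funs J K"

lemma poly_funs_mono:
  assumes "f \<in> poly_funs J K" "K \<le> L"
  shows "f \<in> poly_funs J L"
  using assms(1)
proof induction
  case (monom_add f \<beta> c)
  then show ?case using assms(2) by (intro poly_funs.monom_add) auto
qed (rule poly_funs.zero)

lemma poly_funs_add:
  assumes "f \<in> poly_funs J K" "g \<in> poly_funs J K"
  shows "(\<lambda>t. f t + g t) \<in> poly_funs J K"
  using assms(1)
proof induction
  case zero
  then show ?case using assms(2) by simp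
next
  case (monom_add f \<beta> c)
  then show ?case
    using poly_funs.monom_add[of "\<lambda>t. f t + g t" J K \<beta> c] by (simp add: add.assoc)
qed

lemma poly_funs_monom:
  assumes "\<forall>j\<in>J. \<beta> j \<le> K"
  shows "(\<lambda>t. c * (\<Prod>j\<in>J. t j ^ \<beta> j)) \<in> poly_funs J K"
  using poly_funs.monom_add[OF poly_funs.zero assms, of c] by simp

lemma poly_funs_monom_mult:
  assumes "f \<in> poly_funs J K" "\<forall>j\<in>J. \<beta> j \<le> L"
  shows "(\<lambda>t. c * (\<Prod>j\<in>J. t j ^ \<beta> j) * f t) \<in> poly_funs J (K + L)"
  using assms(1)
proof induction
  case zero
  then show ?case using poly_funs.zero by simp
next
  case (monom_add f \<beta>' c')
  have "(\<lambda>t. (c * c') * (\<Prod>j\<in>J. t j ^ (\<beta> j + \<beta>' j)) + c * (\<Prod>j\<in>J. t j ^ \<beta> j) * f t)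
      \<in> poly_funs J (K + L)"
    using monom_add assms(2) by (intro poly_funs.monom_add) (auto simp: add.commute[of K L] add_mono)
  then show ?case
    by (simp add: power_add prod.distrib algebra_simps)
qed

lemma poly_funs_mult:
  assumes "f \<in> poly_funs J K" "g \<in> poly_funs J L"
  shows "(\<lambda>t. f t * g t) \<in> poly_funs J (K + L)"
  using assms(1)
proof induction
  case zero
  then show ?case using poly_funs.zero by simp
next
  case (monom_add f \<beta> c)
  have "(\<lambda>t. c * (\<Prod>j\<in>J. t j ^ \<beta> j) * g t + f t * g t) \<in> poly_funs J (K + L)"
    using poly_funs_monom_mult[OF assms(2) monom_add.hyps(2), of c] monom_add.IH
    by (intro poly_funs_add) (simp_all add: add.commute)
  then show ?case
    by (simp add: algebra_simps)
qed

lemma poly_funs_const: "(\<lambda>t. c) \<in> poly_funs J K"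
  using poly_funs_monom[of J "\<lambda>_. 0" K c] by simp

lemma poly_funs_var:
  fixes J :: "'x set"
  assumes "finite J" "j \<in> J"
  shows "(\<lambda>t :: 'x \<Rightarrow> 'a::comm_ring_1. t j) \<in> poly_funs J 1"
proof -
  have "(\<Prod>i\<in>J. t i ^ (if i = j then 1 else 0)) = t j" for t :: "'x \<Rightarrow> 'a"
  proof -
    have "(\<Prod>i\<in>J. t i ^ (if i = j then 1 else 0)) = (\<Prod>i\<in>J. if i = j then t i else 1)"
      by (intro prod.cong) auto
    then show ?thesis using assms by simp
  qed
  then show ?thesis
    using poly_funs_monom[of J "\<lambda>i. if i = j then 1 else 0" 1 "1 :: 'a"] by simp
qed

lemma poly_funs_power:
  assumes "f \<in> poly_funs J K"
  shows "(\<lambda>t. f t ^ n) \<in> poly_funs J (n * K)"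
proof (induction n)
  case 0
  then show ?case using poly_funs_const by simp
next
  case (Suc n)
  then show ?case using poly_funs_mult[OF assms Suc] by simp
qed

lemma poly_funs_prod:
  assumes "finite A" "\<And>a. a \<in> A \<Longrightarrow> f a \<in> poly_funs J (k a)"
  shows "(\<lambda>t. \<Prod>a\<in>A. f a t) \<in> poly_funs J (\<Sum>a\<in>A. k a)"
  using assms
proof (induction A rule: finite_induct)
  case empty
  then show ?case using poly_funs_const by simp
next
  case (insert a A)
  then show ?case using poly_funs_mult[of "f a" J "k a"] by simp
qed

lemma poly_funs_sum:
  assumes "finite A" "\<And>a. a \<in> A \<Longrightarrow> f a \<in> poly_funs J K"
  shows "(\<lambda>t. \<Sum>a\<in>A. f a t) \<in> poly_funs J K"
  using assms
proof (induction A rule: finite_induct)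
  case empty
  then show ?case using poly_funs.zero by simp
next
  case (insert a A)
  then show ?case using poly_funs_add[of "f a" J K] by simp
qed

lemma poly_funs_diff:
  fixes f g :: "('x \<Rightarrow> 'a::comm_ring_1) \<Rightarrow> 'a"
  assumes "f \<in> poly_funs J K" "g \<in> poly_funs J K"
  shows "(\<lambda>t. f t - g t) \<in> poly_funs J K"
  using poly_funs_add[OF assms(1), of "\<lambda>t. -1 * g t"]
    poly_funs_mult[OF poly_funs_const[of "-1" J 0] assms(2)] by simp

text \<open>Collecting like monomials turns functions into coefficient vectors over one finite index
  set, ready for linear algebra.\<close>

lemma poly_funs_coefficients:
  fixes f :: "('x \<Rightarrow> 'a::comm_ring_1) \<Rightarrow> 'a"
  assumes "f \<in> poly_funs J K" "finite J"
  shows "\<exists>m. \<forall>t. f t = (\<Sum>\<beta>\<in>J \<rightarrow>\<^sub>E {..K}. m \<beta> * (\<Prod>j\<in>J. t j ^ \<beta> j))"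
  using assms(1)
proof induction
  case zero
  then show ?case by (intro exI[of _ "\<lambda>_. 0"]) simp
next
  case (monom_add f \<beta> c)
  then obtain m where m: "\<And>t. f t = (\<Sum>\<beta>\<in>J \<rightarrow>\<^sub>E {..K}. m \<beta> * (\<Prod>j\<in>J. t j ^ \<beta> j))"
    by blast
  \<comment> \<open>Monomials are indexed by extensional functions, so the exponent is normalized
    outside \<open>J\<close>.\<close>
  define \<beta>' where "\<beta>' = restrict \<beta> J"
  have \<beta>': "\<beta>' \<in> J \<rightarrow>\<^sub>E {..K}" "\<And>t :: 'x \<Rightarrow> 'a. (\<Prod>j\<in>J. t j ^ \<beta> j) = (\<Prod>j\<in>J. t j ^ \<beta>' j)"
    using monom_add by (auto simp: \<beta>'_def)
  have fin: "finite (J \<rightarrow>\<^sub>E {..K})"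
    using assms(2) by (simp add: finite_PiE)
  show ?case
  proof (intro exI[of _ "\<lambda>b. (if b = \<beta>' then c else 0) + m b"] allI)
    fix t
    have "(\<Sum>b\<in>J \<rightarrow>\<^sub>E {..K}. ((if b = \<beta>' then c else 0) + m b) * (\<Prod>j\<in>J. t j ^ b j)) =
        (\<Sum>b\<in>J \<rightarrow>\<^sub>E {..K}. (if b = \<beta>' then c * (\<Prod>j\<in>J. t j ^ b j) else 0)) + f t"
      unfolding m sum.distrib[symmetric] by (intro sum.cong) (auto simp: algebra_simps)
    then show "c * (\<Prod>j\<in>J. t j ^ \<beta> j) + f t =
        (\<Sum>b\<in>J \<rightarrow>\<^sub>E {..K}. ((if b = \<beta>' then c else 0) + m b) * (\<Prod>j\<in>J. t j ^ b j))"
      using \<beta>' fin by simp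
  qed
qed

text \<open>There are more functions than monomials, so the coefficient vectors are linearly
  dependent, and a relation between them is a relation between the functions.\<close>

lemma poly_funs_dependent:
  fixes f :: "'i \<Rightarrow> ('x \<Rightarrow> 'a::field) \<Rightarrow> 'a"
  assumes "finite J" "finite A" "\<And>a. a \<in> A \<Longrightarrow> f a \<in> poly_funs J K" "(K + 1) ^ card J < card A"
  shows "\<exists>c. (\<exists>a\<in>A. c a \<noteq> 0) \<and> (\<forall>t. (\<Sum>a\<in>A. c a * f a t) = 0)"
proof -
  let ?B = "J \<rightarrow>\<^sub>E {..K}"
  have "\<exists>m. \<forall>a\<in>A. \<forall>t. f a t = (\<Sum>\<beta>\<in>?B. m a \<beta> * (\<Prod>j\<in>J. t j ^ \<beta> j))"
    using poly_funs_coefficients[OF assms(3) assms(1)] by (intro bchoice) auto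
  then obtain m where m: "\<And>a t. a \<in> A \<Longrightarrow> f a t = (\<Sum>\<beta>\<in>?B. m a \<beta> * (\<Prod>j\<in>J. t j ^ \<beta> j))"
    by blast
  have "finite ?B" "card ?B = (K + 1) ^ card J"
    using assms(1) by (auto simp: finite_PiE card_PiE)
  then obtain c where c: "\<exists>a\<in>A. c a \<noteq> 0" "\<forall>b\<in>?B. (\<Sum>a\<in>A. c a * m a b) = 0"
    using homogeneous_system_has_nontrivial_solution[of ?B A m] assms by auto
  have "(\<Sum>a\<in>A. c a * f a t) = 0" for t
  proof -
    have "(\<Sum>a\<in>A. c a * f a t) = (\<Sum>a\<in>A. \<Sum>\<beta>\<in>?B. c a * m a \<beta> * (\<Prod>j\<in>J. t j ^ \<beta> j))"
      by (simp add: m sum_distrib_left mult.assoc)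
    also have "\<dots> = (\<Sum>\<beta>\<in>?B. (\<Sum>a\<in>A. c a * m a \<beta>) * (\<Prod>j\<in>J. t j ^ \<beta> j))"
      by (subst sum.swap) (simp add: sum_distrib_right)
    finally show ?thesis using c by simp
  qed
  then show ?thesis using c by blast
qed

section \<open>Restriction of polynomial functions to lines\<close>

lemma poly_funs_on_line:
  assumes "f \<in> poly_funs J K"
  shows "\<exists>P. \<forall>l. f (\<lambda>j. s j + l * (t j - s j)) = poly P l"
  using assms
proof induction
  case zero
  then show ?case by (intro exI[of _ 0]) simp
next
  case (monom_add f \<beta> c)
  then obtain P where "\<forall>l. f (\<lambda>j. s j + l * (t j - s j)) = poly P l" by blast
  then show ?case
    by (intro exI[of _ "[:c:] * (\<Prod>j\<in>J. [:s j, t j - s j:] ^ \<beta> j) + P"])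
      (simp add: poly_prod)
qed

text \<open>Stands in for the density of nonempty open sets: finitely many conditions that each hold
  somewhere on a line hold together at almost all of its points, and the field is infinite.\<close>

lemma poly_fun_zeros_on_line_finite:
  fixes f :: "('x \<Rightarrow> 'a::field) \<Rightarrow> 'a"
  assumes "f \<in> poly_funs J K" "f (\<lambda>j. s j + l0 * (t j - s j)) \<noteq> 0"
  shows "finite {l. f (\<lambda>j. s j + l * (t j - s j)) = 0}"
proof -
  obtain P where P: "\<And>l. f (\<lambda>j. s j + l * (t j - s j)) = poly P l"
    using poly_funs_on_line[OF assms(1)] by metis
  then have "P \<noteq> 0" using assms(2) by auto
  then show ?thesis unfolding P by (rule poly_roots_finite)
qed

section \<open>Evaluation of formal polynomials\<close>

lemma poly_eval_superset:
  assumes "finite S" "Poly_Mapping.keys p \<subseteq> S"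
  shows "poly_eval c p = (\<Sum>m\<in>S. Poly_Mapping.lookup p m *
     (\<Prod>x\<in>Poly_Mapping.keys m. c x ^ Poly_Mapping.lookup m x))"
  unfolding poly_eval_def using assms
  by (intro sum.mono_neutral_left) (auto simp: in_keys_iff)

lemma poly_eval_zero [simp]: "poly_eval c 0 = 0"
  by (simp add: poly_eval_def)

lemma poly_eval_add [simp]: "poly_eval c (p + q) = poly_eval c p + poly_eval c q"
proof -
  let ?S = "Poly_Mapping.keys p \<union> Poly_Mapping.keys q"
  have "Poly_Mapping.keys (p + q) \<subseteq> ?S"
    by (rule Poly_Mapping.keys_add)
  then show ?thesis
    by (simp add: poly_eval_superset[of ?S] lookup_add sum.distrib distrib_right)
qed

lemma poly_eval_sum [simp]: "poly_eval c (sum p A) = (\<Sum>a\<in>A. poly_eval c (p a))"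
  by (induction A rule: infinite_finite_induct) auto

lemma poly_eval_single:
  "poly_eval c (Poly_Mapping.single m a) = a * (\<Prod>x\<in>Poly_Mapping.keys m. c x ^ Poly_Mapping.lookup m x)"
  by (auto simp: poly_eval_def)

lemma monom_eval_superset:
  fixes c :: "'x \<Rightarrow> 'a::comm_ring_1"
  assumes "finite S" "Poly_Mapping.keys m \<subseteq> S"
  shows "(\<Prod>x\<in>Poly_Mapping.keys m. c x ^ Poly_Mapping.lookup m x) = (\<Prod>x\<in>S. c x ^ Poly_Mapping.lookup m x)"
  using assms by (intro prod.mono_neutral_left) (auto simp: in_keys_iff)

lemma monom_eval_add:
  fixes c :: "'x \<Rightarrow> 'a::comm_ring_1"
  shows "(\<Prod>x\<in>Poly_Mapping.keys (m + n). c x ^ Poly_Mapping.lookup (m + n) x) =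
    (\<Prod>x\<in>Poly_Mapping.keys m. c x ^ Poly_Mapping.lookup m x) *
    (\<Prod>x\<in>Poly_Mapping.keys n. c x ^ Poly_Mapping.lookup n x)"
proof -
  let ?S = "Poly_Mapping.keys m \<union> Poly_Mapping.keys n"
  have "Poly_Mapping.keys (m + n) \<subseteq> ?S"
    by (rule Poly_Mapping.keys_add)
  then have "(\<Prod>x\<in>Poly_Mapping.keys (m + n). c x ^ Poly_Mapping.lookup (m + n) x) =
      (\<Prod>x\<in>?S. c x ^ Poly_Mapping.lookup m x) * (\<Prod>x\<in>?S. c x ^ Poly_Mapping.lookup n x)"
    by (subst monom_eval_superset[of ?S]) (auto simp: lookup_add power_add prod.distrib)
  then show ?thesis
    using monom_eval_superset[of ?S m c] monom_eval_superset[of ?S n c] by simp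
qed

lemma poly_mapping_sum_single:
  "p = (\<Sum>m\<in>Poly_Mapping.keys p. Poly_Mapping.single m (Poly_Mapping.lookup p m))"
  by (rule poly_mapping_eqI)
    (auto simp: lookup_sum lookup_single when_def in_keys_iff)

text \<open>Both sides are biadditive, so comparing them on two single monomials is enough.\<close>

lemma poly_eval_mult [simp]: "poly_eval c (p * q) = poly_eval c p * poly_eval c q"
proof -
  have "poly_eval c (Poly_Mapping.single m a * Poly_Mapping.single n b) =
      poly_eval c (Poly_Mapping.single m a) * poly_eval c (Poly_Mapping.single n b)" for m n a b
    by (simp add: mult_single poly_eval_single monom_eval_add mult_ac)
  then have "poly_eval c ((\<Sum>m\<in>Poly_Mapping.keys p. Poly_Mapping.single m (Poly_Mapping.lookup p m)) *
        (\<Sum>m\<in>Poly_Mapping.keys q. Poly_Mapping.single m (Poly_Mapping.lookup q m))) =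
      poly_eval c (\<Sum>m\<in>Poly_Mapping.keys p. Poly_Mapping.single m (Poly_Mapping.lookup p m)) *
      poly_eval c (\<Sum>m\<in>Poly_Mapping.keys q. Poly_Mapping.single m (Poly_Mapping.lookup q m))"
    by (simp add: sum_product)
  then show ?thesis
    by (simp only: poly_mapping_sum_single[symmetric])
qed

lemma poly_eval_one [simp]: "poly_eval c 1 = 1"
  using poly_eval_single[of c 0 1] by simp

lemma poly_eval_power [simp]: "poly_eval c (p ^ n) = poly_eval c p ^ n"
  by (induction n) auto

lemma poly_eval_prod [simp]: "poly_eval c (prod p A) = (\<Prod>a\<in>A. poly_eval c (p a))"
  by (induction A rule: infinite_finite_induct) auto

definition poly_const :: "'a \<Rightarrow> ('x \<Rightarrow>\<^sub>0 nat) \<Rightarrow>\<^sub>0 'a::comm_ring_1" where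
  "poly_const a = Poly_Mapping.single 0 a"

definition poly_var :: "'x \<Rightarrow> ('x \<Rightarrow>\<^sub>0 nat) \<Rightarrow>\<^sub>0 'a::comm_ring_1" where
  "poly_var x = Poly_Mapping.single (Poly_Mapping.single x 1) 1"

lemma poly_eval_const [simp]: "poly_eval c (poly_const a) = a"
  by (simp add: poly_const_def poly_eval_single)

lemma poly_eval_var [simp]: "poly_eval c (poly_var x) = c x"
  by (simp add: poly_var_def poly_eval_single)

text \<open>The passage from formal polynomials in the coordinates of a picture to polynomial
  functions of the parameters of a chart. The bound \<open>L\<close> may depend on
  \<open>p\<close>.\<close>

lemma poly_eval_in_poly_funs:
  fixes \<gamma> :: "('y \<Rightarrow> 'a::comm_ring_1) \<Rightarrow> 'x \<Rightarrow> 'a"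
  assumes "\<And>x. (\<lambda>t. \<gamma> t x) \<in> poly_funs J K"
  shows "\<exists>L. (\<lambda>t. poly_eval (\<gamma> t) p) \<in> poly_funs J L"
proof -
  define k where "k m = (\<Sum>x\<in>Poly_Mapping.keys m. Poly_Mapping.lookup m x * K)" for m :: "'x \<Rightarrow>\<^sub>0 nat"
  define L where "L = (\<Sum>m\<in>Poly_Mapping.keys p. k m)"
  have "(\<lambda>t. Poly_Mapping.lookup p m * (\<Prod>x\<in>Poly_Mapping.keys m. \<gamma> t x ^ Poly_Mapping.lookup m x))
      \<in> poly_funs J L" if m: "m \<in> Poly_Mapping.keys p" for m
  proof -
    have "(\<lambda>t. Poly_Mapping.lookup p m * (\<Prod>x\<in>Poly_Mapping.keys m. \<gamma> t x ^ Poly_Mapping.lookup m x))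
      \<in> poly_funs J (0 + k m)"
      unfolding k_def
      by (intro poly_funs_mult poly_funs_const poly_funs_prod poly_funs_power assms) auto
    moreover have "k m \<le> L"
      unfolding L_def using m by (intro member_le_sum) auto
    ultimately show ?thesis
      by (auto intro: poly_funs_mono)
  qed
  then show ?thesis
    unfolding poly_eval_def by (intro exI[of _ L] poly_funs_sum) auto
qed

section \<open>Points and lines of projective space\<close>

text \<open>The Pluecker coordinates of the line through \<open>x\<close> and \<open>y\<close>. Over
  a field, all of them vanish exactly when the two vectors are linearly dependent.\<close>

definition minor :: "'a::comm_ring_1 ^ 'n \<Rightarrow> 'a ^ 'n \<Rightarrow> 'n \<Rightarrow> 'n \<Rightarrow> 'a" where
  "minor x y i j = x $ i * y $ j - x $ j * y $ i"

lemma eq_scale_of_minors_zero: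
  fixes x y :: "'a::field ^ 'n"
  assumes "x $ i \<noteq> 0" "\<And>j. minor x y i j = 0"
  shows "y = (y $ i / x $ i) *s x"
proof -
  have "y $ j = y $ i / x $ i * x $ j" for j
  proof -
    have "y $ j * x $ i = y $ i * x $ j"
      using assms(2)[of j] unfolding minor_def by (metis eq_iff_diff_eq_0 mult.commute)
    then have "y $ j = y $ i * x $ j / x $ i"
      by (rule nonzero_eq_divide_eq[OF assms(1), THEN iffD2])
    then show ?thesis by simp
  qed
  then show ?thesis unfolding vec_eq_iff vector_smult_component by blast
qed

lemma in_span_pair:
  fixes x y z :: "'a::field ^ 'n"
  shows "z \<in> vec.span {x, y} \<longleftrightarrow> (\<exists>a b. z = a *s x + b *s y)"
proof
  assume "z \<in> vec.span {x, y}"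
  then obtain a b where "z - a *s x = b *s y"
    by (auto simp: vec.span_breakdown_eq[of z x] vec.span_singleton)
  then have "z = a *s x + b *s y" by (simp add: algebra_simps)
  then show "\<exists>a b. z = a *s x + b *s y" by blast
next
  assume "\<exists>a b. z = a *s x + b *s y"
  then obtain a b where "z = a *s x + b *s y" by blast
  then show "z \<in> vec.span {x, y}"
    by (simp add: vec.span_add vec.span_scale vec.span_base)
qed

text \<open>If all minors vanish, both vectors are multiples of a single one, which spans at most a
  dimension. A nonzero minor rules out proportionality.\<close>

lemma span_pair_dim_2_iff:
  fixes x y :: "'a::field ^ 'n"
  shows "vec.dim (vec.span {x, y}) = 2 \<longleftrightarrow> (\<exists>i j. minor x y i j \<noteq> 0)"
proof
  assume dim: "vec.dim (vec.span {x, y}) = 2"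
  show "\<exists>i j. minor x y i j \<noteq> 0"
  proof (rule ccontr)
    assume "\<not> (\<exists>i j. minor x y i j \<noteq> 0)"
    then have m: "minor x y i j = 0" for i j
      by blast
    have "\<exists>z. vec.span {x, y} = vec.span {z}"
    proof (cases "x = 0")
      case True
      then show ?thesis by (intro exI[of _ y]) simp
    next
      case False
      then obtain i where i: "x $ i \<noteq> 0" by (auto simp: vec_eq_iff)
      then have "y = (y $ i / x $ i) *s x"
        using eq_scale_of_minors_zero m by blast
      then have "y \<in> vec.span {x}" unfolding vec.span_singleton by blast
      then have "vec.span (insert y {x}) = vec.span {x}" by (rule vec.span_redundant)
      then show ?thesis unfolding insert_commute[of x y] by blast
    qed
    then obtain z where "vec.span {x, y} = vec.span {z}" by blast
    then have "vec.dim {z} = 2" using dim by (metis vec.dim_span)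
    then show False by (simp split: if_splits)
  qed
next
  assume "\<exists>i j. minor x y i j \<noteq> 0"
  then obtain i j where ij: "minor x y i j \<noteq> 0" by blast
  then have "y \<noteq> 0" by (auto simp: minor_def)
  moreover have "x \<notin> vec.span {y}"
  proof
    assume "x \<in> vec.span {y}"
    then obtain k where "x = k *s y" by (auto simp: vec.span_singleton)
    then show False using ij by (simp add: minor_def)
  qed
  moreover from this have "x \<noteq> y" by (auto intro: vec.span_base)
  ultimately have "vec.independent {x, y}"
    by (simp add: vec.independent_insert)
  then show "vec.dim (vec.span {x, y}) = 2"
    using \<open>x \<noteq> y\<close> by (simp add: vec.dim_eq_card_independent)
qed

text \<open>The factor \<open>k\<close> is the determinant of the matrix expressing
  \<open>x'\<close>, \<open>y'\<close> in terms of \<open>x\<close>, \<open>y\<close>.\<close>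

lemma minor_in_span_pair:
  fixes x y :: "'a::field ^ 'n"
  assumes "x' \<in> vec.span {x, y}" "y' \<in> vec.span {x, y}"
  shows "\<exists>k. \<forall>i j. minor x' y' i j = k * minor x y i j"
proof -
  obtain a b c d where "x' = a *s x + b *s y" "y' = c *s x + d *s y"
    using assms by (auto simp: in_span_pair)
  then have "minor x' y' i j = (a * d - b * c) * minor x y i j" for i j
    by (simp add: minor_def algebra_simps)
  then show ?thesis by blast
qed

lemma span_pair_eqI:
  fixes x y :: "'a::field ^ 'n"
  assumes "vec.subspace U" "vec.dim U = 2" "x \<in> U" "y \<in> U" "minor x y i j \<noteq> 0"
  shows "vec.span {x, y} = U"
proof (rule vec.subspace_dim_equal)
  show "vec.span {x, y} \<subseteq> U"
    using assms by (intro vec.span_minimal) auto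
  show "vec.dim U \<le> vec.dim (vec.span {x, y})"
    using assms span_pair_dim_2_iff[of x y] by auto
qed (use assms in auto)

lemma proj_pointE:
  assumes "U \<in> proj_points"
  obtains x where "x \<noteq> 0" "U = vec.span {x}"
proof -
  from assms have U: "vec.subspace U" "vec.dim U = 1" by (auto simp: proj_points_def)
  obtain C where C: "C \<subseteq> U" "vec.independent C" "U \<subseteq> vec.span C" "card C = vec.dim U"
    using vec.basis_exists[of U] by metis
  then obtain x where "C = {x}" using U card_1_singletonE by metis
  then have "U = vec.span {x}" "x \<noteq> 0"
    using C U vec.span_subspace[of C U] vec.dependent_zero[of C] by auto
  then show ?thesis using that by blast
qed

lemma proj_lineE:
  assumes "U \<in> proj_lines"
  obtains x y where "U = vec.span {x, y}"
proof -
  from assms have U: "vec.subspace U" "vec.dim U = 2" by (auto simp: proj_lines_def)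
  obtain C where C: "C \<subseteq> U" "vec.independent C" "U \<subseteq> vec.span C" "card C = vec.dim U"
    using vec.basis_exists[of U] by metis
  then obtain x y where "C = {x, y}" using U card_2_iff by metis
  then have "U = vec.span {x, y}"
    using C U vec.span_subspace[of C U] by auto
  then show ?thesis using that by blast
qed

lemma span_singleton_proj_point: "x \<noteq> 0 \<Longrightarrow> vec.span {x} \<in> proj_points"
  by (simp add: proj_points_def)

lemma span_pair_proj_line: "minor x y i j \<noteq> 0 \<Longrightarrow> vec.span {x, y} \<in> proj_lines"
  using span_pair_dim_2_iff[of x y] by (auto simp: proj_lines_def simp del: vec.dim_span)

lemma span_singleton_eq_scale:
  fixes x y :: "'a::field ^ 'n"
  assumes "vec.span {x} = vec.span {y}" "x \<noteq> 0"
  shows "\<exists>k. k \<noteq> 0 \<and> x = k *s y"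
proof -
  have "x \<in> vec.span {y}" using assms(1) vec.span_base[of x "{x}"] by auto
  then obtain k where "x = k *s y" by (auto simp: vec.span_singleton)
  then show ?thesis using assms(2) by (intro exI[of _ k]) auto
qed

lemma span_scale_singleton:
  fixes x :: "'a::field ^ 'n"
  assumes "k \<noteq> 0"
  shows "vec.span {k *s x} = vec.span {x}"
proof
  show "vec.span {k *s x} \<subseteq> vec.span {x}"
    by (rule vec.span_minimal) (auto intro: vec.span_scale vec.span_base)
  have "x = inverse k *s (k *s x)" using assms by simp
  then have "x \<in> vec.span {k *s x}" by (metis vec.span_base vec.span_scale singletonI)
  then show "vec.span {x} \<subseteq> vec.span {k *s x}"
    by (intro vec.span_minimal) auto
qed

text \<open>Turns equality of two points into bilinear equations in their homogeneous coordinates,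
  hence into a closed condition.\<close>

lemma span_singleton_eq_iff_minors:
  fixes x y :: "'a::field ^ 'n"
  assumes "x \<noteq> 0" "y \<noteq> 0"
  shows "vec.span {x} = vec.span {y} \<longleftrightarrow> (\<forall>i j. minor x y i j = 0)"
proof
  assume "vec.span {x} = vec.span {y}"
  then obtain k where "x = k *s y" using span_singleton_eq_scale assms by blast
  then show "\<forall>i j. minor x y i j = 0" by (simp add: minor_def)
next
  assume m: "\<forall>i j. minor x y i j = 0"
  obtain i where i: "x $ i \<noteq> 0" using assms by (auto simp: vec_eq_iff)
  then have y: "y = (y $ i / x $ i) *s x"
    using eq_scale_of_minors_zero m by blast
  then have "y $ i / x $ i \<noteq> 0" using assms by (metis vec.scale_zero_left)
  then show "vec.span {x} = vec.span {y}" using span_scale_singleton y by metis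
qed

section \<open>Multihomogeneous polynomials and their zero loci\<close>

text \<open>\<open>multihomogeneous\<close> with the degrees exposed: a sum is again homogeneous
  only when the degrees of its terms agree, which the existential form hides.\<close>

definition has_multidegree ::
    "'v set \<Rightarrow> 'v set set \<Rightarrow> ('v \<Rightarrow> nat) \<Rightarrow> ('v set \<Rightarrow> nat) \<Rightarrow>
     ('a::field, 'n::finite, 'v) picture_poly \<Rightarrow> bool" where
  "has_multidegree V E a b p \<longleftrightarrow> (\<forall>v. v \<notin> V \<longrightarrow> a v = 0) \<and> (\<forall>e. e \<notin> E \<longrightarrow> b e = 0) \<and>
     (\<forall>m\<in>Poly_Mapping.keys p.
        (\<forall>v. (\<Sum>i\<in>UNIV. Poly_Mapping.lookup m (PointCoord v i)) = a v) \<and>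
        (\<forall>e. (\<Sum>i\<in>UNIV. \<Sum>j\<in>UNIV. Poly_Mapping.lookup m (LineCoord e i j)) = b e))"

lemma multihomogeneous_iff: "multihomogeneous V E p \<longleftrightarrow> (\<exists>a b. has_multidegree V E a b p)"
  by (simp add: multihomogeneous_def has_multidegree_def)

lemma has_multidegree_superset:
  assumes "has_multidegree B F a b p" "B \<subseteq> V" "F \<subseteq> E"
  shows "has_multidegree V E a b p"
  using assms unfolding has_multidegree_def by blast

lemma has_multidegree_0:
  "(\<And>v. v \<notin> V \<Longrightarrow> a v = 0) \<Longrightarrow> (\<And>e. e \<notin> E \<Longrightarrow> b e = 0) \<Longrightarrow> has_multidegree V E a b 0"
  by (simp add: has_multidegree_def)

lemma has_multidegree_add:
  assumes "has_multidegree V E a b p" "has_multidegree V E a b q"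
  shows "has_multidegree V E a b (p + q)"
  using assms Poly_Mapping.keys_add[of p q] unfolding has_multidegree_def by blast

lemma has_multidegree_sum:
  assumes "\<And>x. x \<in> A \<Longrightarrow> has_multidegree V E a b (p x)"
    "\<And>v. v \<notin> V \<Longrightarrow> a v = 0" "\<And>e. e \<notin> E \<Longrightarrow> b e = 0"
  shows "has_multidegree V E a b (sum p A)"
  using assms(1)
  by (induction A rule: infinite_finite_induct)
    (auto intro: has_multidegree_0 has_multidegree_add assms(2,3))

lemma has_multidegree_mult:
  assumes "has_multidegree V E a b p" "has_multidegree V E a' b' q"
  shows "has_multidegree V E (\<lambda>v. a v + a' v) (\<lambda>e. b e + b' e) (p * q)"
  unfolding has_multidegree_def
proof (intro conjI ballI allI impI)
  fix m assume "m \<in> Poly_Mapping.keys (p * q)"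
  then obtain m1 m2 where m: "m = m1 + m2" "m1 \<in> Poly_Mapping.keys p" "m2 \<in> Poly_Mapping.keys q"
    using keys_mult[of p q] by blast
  show "(\<Sum>i\<in>UNIV. Poly_Mapping.lookup m (PointCoord v i)) = a v + a' v" for v
    using assms m by (simp add: has_multidegree_def lookup_add sum.distrib)
  show "(\<Sum>i\<in>UNIV. \<Sum>j\<in>UNIV. Poly_Mapping.lookup m (LineCoord e i j)) = b e + b' e" for e
    using assms m by (simp add: has_multidegree_def lookup_add sum.distrib)
qed (use assms in \<open>auto simp: has_multidegree_def\<close>)

lemma has_multidegree_const: "has_multidegree V E (\<lambda>_. 0) (\<lambda>_. 0) (poly_const c)"
  by (auto simp: has_multidegree_def poly_const_def split: if_splits)

lemma has_multidegree_one: "has_multidegree V E (\<lambda>_. 0) (\<lambda>_. 0) 1"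
  using has_multidegree_const[of V E 1] by (simp add: poly_const_def)

lemma has_multidegree_power:
  assumes "has_multidegree V E a b p"
  shows "has_multidegree V E (\<lambda>v. n * a v) (\<lambda>e. n * b e) (p ^ n)"
proof (induction n)
  case 0
  then show ?case using has_multidegree_one by simp
next
  case (Suc n)
  show ?case using has_multidegree_mult[OF assms Suc] by simp
qed

lemma has_multidegree_prod:
  assumes "finite A" "\<And>x. x \<in> A \<Longrightarrow> has_multidegree V E (a x) (b x) (p x)"
  shows "has_multidegree V E (\<lambda>v. \<Sum>x\<in>A. a x v) (\<lambda>e. \<Sum>x\<in>A. b x e) (prod p A)"
  using assms
proof (induction A rule: finite_induct)
  case empty
  then show ?case using has_multidegree_one by simp
next
  case (insert x A)
  then show ?case
    using has_multidegree_mult[of V E "a x" "b x" "p x"] by simp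
qed

lemma has_multidegree_point_var:
  assumes "v \<in> V"
  shows "has_multidegree V E (\<lambda>w. if w = v then 1 else 0) (\<lambda>_. 0) (poly_var (PointCoord v i))"
  using assms by (auto simp: has_multidegree_def poly_var_def lookup_single when_def)

lemma has_multidegree_line_var:
  assumes "e \<in> E"
  shows "has_multidegree V E (\<lambda>_. 0) (\<lambda>f. if f = e then 1 else 0) (poly_var (LineCoord e i j))"
proof -
  have "(\<Sum>k\<in>UNIV. \<Sum>l\<in>UNIV. if i = k \<and> j = l then 1 else 0) = (1::nat)"
  proof -
    have "(\<Sum>k\<in>UNIV. \<Sum>l\<in>UNIV. if i = k \<and> j = l then 1 else 0) =
        (\<Sum>k\<in>UNIV. if i = k then 1 else (0::nat))"
      by (intro sum.cong) auto
    then show ?thesis by simp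
  qed
  then show ?thesis
    using assms by (auto simp: has_multidegree_def poly_var_def lookup_single when_def simp del: One_nat_def)
qed

text \<open>The degrees are already 0 at vertices and edges outside the subgraph. This lets an
  equation on \<open>H\<close> be read as an equation on \<open>G\<close>.\<close>

lemma multihomogeneous_superset:
  assumes "multihomogeneous B F p" "B \<subseteq> V" "F \<subseteq> E"
  shows "multihomogeneous V E p"
  using assms has_multidegree_superset unfolding multihomogeneous_iff by blast

lemma multihomogeneous_mult:
  "multihomogeneous V E p \<Longrightarrow> multihomogeneous V E q \<Longrightarrow> multihomogeneous V E (p * q)"
  using has_multidegree_mult unfolding multihomogeneous_iff by blast

lemma multihomogeneous_one: "multihomogeneous V E 1"
  using has_multidegree_one unfolding multihomogeneous_iff by blast

lemma multihomogeneous_prod: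
  assumes "finite A" "\<And>x. x \<in> A \<Longrightarrow> multihomogeneous V E (p x)"
  shows "multihomogeneous V E (prod p A)"
  using assms by (induction A rule: finite_induct) (auto intro: multihomogeneous_mult multihomogeneous_one)

section \<open>Coordinates of a picture and their rescaling\<close>

lemma ambient_space_point: "P \<in> ambient_space V E \<Longrightarrow> v \<in> V \<Longrightarrow> fst P v \<in> proj_points"
  by (auto simp: ambient_space_def)

lemma ambient_space_line: "P \<in> ambient_space V E \<Longrightarrow> e \<in> E \<Longrightarrow> snd P e \<in> proj_lines"
  by (auto simp: ambient_space_def)

lemma coordinates_of_exists:
  assumes "P \<in> ambient_space V E"
  shows "\<exists>c. coordinates_of V E P c"
proof -
  have "\<forall>v\<in>V. \<exists>x. fst P v = vec.span {x}"
    using ambient_space_point[OF assms] by (meson proj_pointE)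
  then obtain x where x: "\<forall>v\<in>V. fst P v = vec.span {x v}"
    using bchoice by metis
  have "\<forall>e\<in>E. \<exists>z. snd P e = vec.span {fst z, snd z}"
  proof
    fix e assume "e \<in> E"
    then obtain u w where "snd P e = vec.span {u, w}"
      using ambient_space_line[OF assms] by (metis proj_lineE)
    then show "\<exists>z. snd P e = vec.span {fst z, snd z}"
      by (intro exI[of _ "(u, w)"]) simp
  qed
  then obtain z where z: "\<forall>e\<in>E. snd P e = vec.span {fst (z e), snd (z e)}"
    using bchoice by metis
  define c where "c = (\<lambda>k. case k of PointCoord v i \<Rightarrow> x v $ i
      | LineCoord e i j \<Rightarrow> minor (fst (z e)) (snd (z e)) i j)"
  have "coordinates_of V E P c"
    unfolding coordinates_of_def
  proof (intro conjI ballI)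
    fix v assume "v \<in> V"
    then show "\<exists>u. vec.span {u} = fst P v \<and> (\<forall>i. c (PointCoord v i) = u $ i)"
      using x by (intro exI[of _ "x v"]) (auto simp: c_def)
  next
    fix e assume "e \<in> E"
    then show "\<exists>x y. vec.span {x, y} = snd P e \<and>
        (\<forall>i j. c (LineCoord e i j) = x $ i * y $ j - x $ j * y $ i)"
      using z by (intro exI[of _ "fst (z e)"] exI[of _ "snd (z e)"]) (auto simp: c_def minor_def)
  qed
  then show ?thesis by blast
qed

text \<open>Two vectors spanning the same point are proportional, and the minors of two bases of the
  same plane differ by the determinant of the base change.\<close>

lemma coordinates_of_unique_up_to_scaling:
  fixes P :: "('a::field, 'n::finite, 'v) picture"
  assumes P: "P \<in> ambient_space V E" and c: "coordinates_of V E P c" and c': "coordinates_of V E P c'"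
  obtains l k where
    "\<And>v i. v \<in> V \<Longrightarrow> l v \<noteq> 0 \<and> c' (PointCoord v i) = l v * c (PointCoord v i)"
    "\<And>e i j. e \<in> E \<Longrightarrow> k e \<noteq> 0 \<and> c' (LineCoord e i j) = k e * c (LineCoord e i j)"
proof -
  have "\<forall>v\<in>V. \<exists>l. l \<noteq> 0 \<and> (\<forall>i. c' (PointCoord v i) = l * c (PointCoord v i))"
  proof
    fix v assume v: "v \<in> V"
    obtain x where x: "vec.span {x} = fst P v" "\<And>i. c (PointCoord v i) = x $ i"
      using c v unfolding coordinates_of_def by blast
    obtain x' where x': "vec.span {x'} = fst P v" "\<And>i. c' (PointCoord v i) = x' $ i"
      using c' v unfolding coordinates_of_def by blast
    have "vec.dim (vec.span {x'}) = 1"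
      using ambient_space_point[OF P v] x' by (simp add: proj_points_def)
    then have "x' \<noteq> 0" by auto
    then obtain l where "l \<noteq> 0" "x' = l *s x"
      using span_singleton_eq_scale[of x' x] x x' by auto
    then show "\<exists>l. l \<noteq> 0 \<and> (\<forall>i. c' (PointCoord v i) = l * c (PointCoord v i))"
      using x x' by auto
  qed
  then obtain l where l: "\<forall>v\<in>V. l v \<noteq> 0 \<and> (\<forall>i. c' (PointCoord v i) = l v * c (PointCoord v i))"
    using bchoice[of V "\<lambda>v l. l \<noteq> 0 \<and> (\<forall>i. c' (PointCoord v i) = l * c (PointCoord v i))"] by blast
  have "\<forall>e\<in>E. \<exists>k. k \<noteq> 0 \<and> (\<forall>i j. c' (LineCoord e i j) = k * c (LineCoord e i j))"
  proof
    fix e assume e: "e \<in> E"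
    obtain x y where x: "vec.span {x, y} = snd P e" "\<And>i j. c (LineCoord e i j) = minor x y i j"
      using c e unfolding coordinates_of_def minor_def by blast
    obtain x' y' where x': "vec.span {x', y'} = snd P e" "\<And>i j. c' (LineCoord e i j) = minor x' y' i j"
      using c' e unfolding coordinates_of_def minor_def by blast
    have "vec.dim (vec.span {x', y'}) = 2"
      using ambient_space_line[OF P e] x' by (simp add: proj_lines_def)
    then obtain i j where ij: "minor x' y' i j \<noteq> 0"
      unfolding span_pair_dim_2_iff by blast
    have "x' \<in> vec.span {x, y}" "y' \<in> vec.span {x, y}"
      using x(1) x'(1) vec.span_base[of _ "{x', y'}"] by auto
    then obtain k where k: "\<forall>i j. minor x' y' i j = k * minor x y i j"
      using minor_in_span_pair by blast
    then have "k \<noteq> 0" using ij by auto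
    then show "\<exists>k. k \<noteq> 0 \<and> (\<forall>i j. c' (LineCoord e i j) = k * c (LineCoord e i j))"
      using k x x' by auto
  qed
  then obtain k where k: "\<forall>e\<in>E. k e \<noteq> 0 \<and> (\<forall>i j. c' (LineCoord e i j) = k e * c (LineCoord e i j))"
    using bchoice[of E "\<lambda>e k. k \<noteq> 0 \<and> (\<forall>i j. c' (LineCoord e i j) = k * c (LineCoord e i j))"] by blast
  show ?thesis using l k by (intro that) auto
qed

text \<open>The multidegree prescribes how many variables of each vertex and each edge a monomial
  contains, so rescaling multiplies every monomial by the same factor.\<close>

lemma poly_eval_rescale:
  fixes c c' :: "('n::finite, 'v) coord \<Rightarrow> 'a::field"
  assumes fin: "finite V" "finite E" and p: "has_multidegree V E a b p"
    and l: "\<And>v i. v \<in> V \<Longrightarrow> c' (PointCoord v i) = l v * c (PointCoord v i)"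
    and k: "\<And>e i j. e \<in> E \<Longrightarrow> c' (LineCoord e i j) = k e * c (LineCoord e i j)"
  shows "poly_eval c' p = (\<Prod>v\<in>V. l v ^ a v) * (\<Prod>e\<in>E. k e ^ b e) * poly_eval c p"
proof -
  \<comment> \<open>\<open>X1\<close> and \<open>X2\<close> contain all variables that can occur.
    Extending every monomial to their union gives products that can be regrouped by vertex and by
    edge.\<close>
  define X1 :: "('n, 'v) coord set" where "X1 = (\<lambda>(v, i). PointCoord v i) ` (V \<times> UNIV)"
  define X2 :: "('n, 'v) coord set" where "X2 = (\<lambda>(e, i, j). LineCoord e i j) ` (E \<times> UNIV \<times> UNIV)"
  define s where "s x = (case x of PointCoord v i \<Rightarrow> l v | LineCoord e i j \<Rightarrow> k e)"
    for x :: "('n, 'v) coord"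
  have fX: "finite X1" "finite X2" using fin by (auto simp: X1_def X2_def)
  have disj: "X1 \<inter> X2 = {}" by (auto simp: X1_def X2_def)
  have cs: "c' x = s x * c x" if "x \<in> X1 \<union> X2" for x
    using that l k by (auto simp: X1_def X2_def s_def)
  have monom: "(\<Prod>x\<in>Poly_Mapping.keys m. c' x ^ Poly_Mapping.lookup m x) =
      (\<Prod>v\<in>V. l v ^ a v) * (\<Prod>e\<in>E. k e ^ b e) *
      (\<Prod>x\<in>Poly_Mapping.keys m. c x ^ Poly_Mapping.lookup m x)"
    if m: "m \<in> Poly_Mapping.keys p" for m
  proof -
    have a: "(\<Sum>i\<in>UNIV. Poly_Mapping.lookup m (PointCoord v i)) = a v" for v
      using p m by (simp add: has_multidegree_def)
    have b: "(\<Sum>i\<in>UNIV. \<Sum>j\<in>UNIV. Poly_Mapping.lookup m (LineCoord e i j)) = b e" for e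
      using p m by (simp add: has_multidegree_def)
    \<comment> \<open>A variable of a vertex or edge outside the graph would make the degree there
      positive.\<close>
    have keys: "Poly_Mapping.keys m \<subseteq> X1 \<union> X2"
    proof
      fix x assume x: "x \<in> Poly_Mapping.keys m"
      show "x \<in> X1 \<union> X2"
      proof (cases x)
        case (PointCoord v i)
        have "a v \<noteq> 0" unfolding a[symmetric] using x by (auto simp: PointCoord in_keys_iff)
        then have "v \<in> V" using p by (auto simp: has_multidegree_def)
        then show ?thesis by (auto simp: PointCoord X1_def)
      next
        case (LineCoord e i j)
        have "b e \<noteq> 0" unfolding b[symmetric] using x by (auto simp: LineCoord in_keys_iff)
        then have "e \<in> E" using p by (auto simp: has_multidegree_def)
        then show ?thesis by (auto simp: LineCoord X2_def intro!: image_eqI[of _ _ "(e, i, j)"])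
      qed
    qed
    have "(\<Prod>x\<in>X1. s x ^ Poly_Mapping.lookup m x) = (\<Prod>v\<in>V. \<Prod>i\<in>UNIV. l v ^ Poly_Mapping.lookup m (PointCoord v i))"
      unfolding X1_def by (subst prod.reindex) (auto simp: inj_on_def s_def prod.cartesian_product split_def)
    also have "\<dots> = (\<Prod>v\<in>V. l v ^ a v)"
      unfolding a[symmetric] by (simp add: power_sum)
    finally have s1: "(\<Prod>x\<in>X1. s x ^ Poly_Mapping.lookup m x) = (\<Prod>v\<in>V. l v ^ a v)" .
    have "(\<Prod>x\<in>X2. s x ^ Poly_Mapping.lookup m x) =
        (\<Prod>e\<in>E. \<Prod>i\<in>UNIV. \<Prod>j\<in>UNIV. k e ^ Poly_Mapping.lookup m (LineCoord e i j))"
      unfolding X2_def by (subst prod.reindex) (auto simp: inj_on_def s_def prod.cartesian_product split_def)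
    also have "\<dots> = (\<Prod>e\<in>E. k e ^ b e)"
      unfolding b[symmetric] by (simp add: power_sum)
    finally have s2: "(\<Prod>x\<in>X2. s x ^ Poly_Mapping.lookup m x) = (\<Prod>e\<in>E. k e ^ b e)" .
    have "(\<Prod>x\<in>Poly_Mapping.keys m. c' x ^ Poly_Mapping.lookup m x) =
        (\<Prod>x\<in>X1 \<union> X2. c' x ^ Poly_Mapping.lookup m x)"
      using fX keys by (intro monom_eval_superset) auto
    also have "\<dots> = (\<Prod>x\<in>X1 \<union> X2. s x ^ Poly_Mapping.lookup m x) * (\<Prod>x\<in>X1 \<union> X2. c x ^ Poly_Mapping.lookup m x)"
      unfolding prod.distrib[symmetric] by (intro prod.cong) (auto simp: cs power_mult_distrib)
    also have "(\<Prod>x\<in>X1 \<union> X2. s x ^ Poly_Mapping.lookup m x) = (\<Prod>v\<in>V. l v ^ a v) * (\<Prod>e\<in>E. k e ^ b e)"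
      using fX disj by (simp add: prod.union_disjoint s1 s2)
    also have "(\<Prod>x\<in>X1 \<union> X2. c x ^ Poly_Mapping.lookup m x) =
        (\<Prod>x\<in>Poly_Mapping.keys m. c x ^ Poly_Mapping.lookup m x)"
      using fX keys by (intro monom_eval_superset[symmetric]) auto
    finally show ?thesis .
  qed
  show ?thesis
    unfolding poly_eval_def sum_distrib_left
    by (intro sum.cong) (auto simp: monom mult_ac)
qed

section \<open>Zero loci and the Zariski topology\<close>

text \<open>Interpreted twice in the final proof: for the whole graph and for the subgraph induced
  on \<open>B\<close>.\<close>

locale finite_config =
  fixes V :: "'v set" and E :: "'v set set"
  assumes finite_V: "finite V" and finite_E: "finite E"
begin

text \<open>Another choice of coordinates multiplies the value of \<open>p\<close> by a constant, so
  a zero for one choice is a zero for all.\<close>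

lemma zero_locus_iff:
  assumes "multihomogeneous V E p" "P \<in> ambient_space V E" "coordinates_of V E P c"
  shows "P \<in> zero_locus V E p \<longleftrightarrow> poly_eval c p = 0"
proof
  assume "P \<in> zero_locus V E p"
  then show "poly_eval c p = 0" using assms(3) by (auto simp: zero_locus_def)
next
  assume z: "poly_eval c p = 0"
  obtain a b where p: "has_multidegree V E a b p" using assms(1) multihomogeneous_iff by blast
  have "poly_eval c' p = 0" if c': "coordinates_of V E P c'" for c'
  proof -
    obtain l k where
      "\<And>v i. v \<in> V \<Longrightarrow> l v \<noteq> 0 \<and> c' (PointCoord v i) = l v * c (PointCoord v i)"
      "\<And>e i j. e \<in> E \<Longrightarrow> k e \<noteq> 0 \<and> c' (LineCoord e i j) = k e * c (LineCoord e i j)"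
      using coordinates_of_unique_up_to_scaling[OF assms(2,3) c'] by blast
    then have "poly_eval c' p = (\<Prod>v\<in>V. l v ^ a v) * (\<Prod>e\<in>E. k e ^ b e) * poly_eval c p"
      by (intro poly_eval_rescale[OF finite_V finite_E p]) auto
    then show ?thesis using z by simp
  qed
  then show "P \<in> zero_locus V E p" using assms(2) by (auto simp: zero_locus_def)
qed

definition coords :: "('a::field, 'n::finite, 'v) picture \<Rightarrow> ('n, 'v) coord \<Rightarrow> 'a" where
  "coords P = (SOME c. coordinates_of V E P c)"

lemma coordinates_of_coords: "P \<in> ambient_space V E \<Longrightarrow> coordinates_of V E P (coords P)"
  unfolding coords_def using coordinates_of_exists by (rule someI_ex)

lemma zero_locus_coords:
  "multihomogeneous V E p \<Longrightarrow> P \<in> ambient_space V E \<Longrightarrow> P \<in> zero_locus V E p \<longleftrightarrow> poly_eval (coords P) p = 0"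
  using zero_locus_iff coordinates_of_coords by blast

lemma zero_locus_subset: "zero_locus V E p \<subseteq> ambient_space V E"
  by (auto simp: zero_locus_def)

text \<open>With one fixed choice \<open>coords P\<close> of coordinates for both factors, this is
  the absence of zero divisors.\<close>

lemma zero_locus_mult:
  assumes "multihomogeneous V E p" "multihomogeneous V E q"
  shows "zero_locus V E (p * q) = zero_locus V E p \<union> zero_locus V E q"
proof -
  have "P \<in> zero_locus V E (p * q) \<longleftrightarrow> P \<in> zero_locus V E p \<union> zero_locus V E q"
    if "P \<in> ambient_space V E" for P
    using that by (simp add: assms zero_locus_coords multihomogeneous_mult)
  then show ?thesis
    using zero_locus_subset[of p] zero_locus_subset[of q] zero_locus_subset[of "p * q"] by blast
qed

lemma zero_locus_one: "zero_locus V E 1 = {}"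
proof -
  have "P \<notin> zero_locus V E 1" if "P \<in> ambient_space V E" for P
    using that by (simp add: zero_locus_coords multihomogeneous_one)
  then show ?thesis
    using zero_locus_subset[of 1] by blast
qed

lemma zero_locus_prod:
  assumes "finite A" "\<And>x. x \<in> A \<Longrightarrow> multihomogeneous V E (p x)"
  shows "zero_locus V E (prod p A) = (\<Union>x\<in>A. zero_locus V E (p x))"
  using assms
  by (induction A rule: finite_induct) (auto simp: zero_locus_one zero_locus_mult multihomogeneous_prod)

lemma topspace_zariski_topology:
  "topspace (zariski_topology V E :: ('a::field, 'n::finite, 'v) picture topology) = ambient_space V E"
proof -
  have "ambient_space V E \<in> {ambient_space V E - zero_locus V E p | p :: ('a, 'n, 'v) picture_poly. multihomogeneous V E p}"
    using multihomogeneous_one zero_locus_one by (metis (mono_tags, lifting) Diff_empty mem_Collect_eq)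
  then show ?thesis unfolding zariski_topology_def topology_generated_by_topspace by blast
qed

lemma closedin_zero_locus:
  "multihomogeneous V E p \<Longrightarrow> closedin (zariski_topology V E) (zero_locus V E p)"
  unfolding closedin_def topspace_zariski_topology
  using zero_locus_subset[of p] by (auto simp: zariski_topology_def intro: topology_generated_by_Basis)

text \<open>Products of polynomials make the generating sets closed under intersection, so they form
  a base and not only a subbase.\<close>

lemma zariski_open_separation:
  fixes P :: "('a::field, 'n::finite, 'v) picture"
  assumes "openin (zariski_topology V E) U" "P \<in> U"
  shows "\<exists>p. multihomogeneous V E p \<and> P \<in> ambient_space V E - zero_locus V E p \<and>
    ambient_space V E - zero_locus V E p \<subseteq> U"
proof -
  have "generate_topology_on {ambient_space V E - zero_locus V E p | p :: ('a, 'n, 'v) picture_poly. multihomogeneous V E p} U"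
    using assms(1) unfolding zariski_topology_def by (rule openin_topology_generated_by)
  then show ?thesis using assms(2)
  proof induction
    case (Int a b)
    then obtain p q where
      "multihomogeneous V E p \<and> P \<in> ambient_space V E - zero_locus V E p \<and> ambient_space V E - zero_locus V E p \<subseteq> a"
      "multihomogeneous V E q \<and> P \<in> ambient_space V E - zero_locus V E q \<and> ambient_space V E - zero_locus V E q \<subseteq> b"
      by blast
    then show ?case
      by (intro exI[of _ "p * q"]) (auto simp: zero_locus_mult multihomogeneous_mult)
  next
    case (UN K)
    then show ?case by blast
  qed auto
qed

lemma topspace_picture_topology: "topspace (picture_topology V E) = picture_space V E"
  by (auto simp: picture_topology_def topspace_zariski_topology picture_space_def)

lemma picture_space_subset: "picture_space V E \<subseteq> ambient_space V E"
  by (auto simp: picture_space_def)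

section \<open>Irreducible sets and closures in terms of polynomials\<close>

text \<open>Irreducibility tested on pairs of single polynomials. No subspace is mentioned, so
  members of a chain in one cellule can be compared with a chart of another.\<close>

definition irreducible_locus :: "('a::field, 'n::finite, 'v) picture set \<Rightarrow> bool" where
  "irreducible_locus Z \<longleftrightarrow> Z \<noteq> {} \<and> Z \<subseteq> ambient_space V E \<and>
    (\<forall>p q. multihomogeneous V E p \<longrightarrow> multihomogeneous V E q \<longrightarrow>
      Z \<subseteq> zero_locus V E p \<union> zero_locus V E q \<longrightarrow> Z \<subseteq> zero_locus V E p \<or> Z \<subseteq> zero_locus V E q)"

text \<open>For \<open>W\<close> inside the ambient space this is its Zariski closure, in the form
  in which it is applied: every equation of \<open>W\<close> holds on it.\<close>

definition zero_closure :: "('a::field, 'n::finite, 'v) picture set \<Rightarrow> ('a, 'n, 'v) picture set" where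
  "zero_closure W = {P. \<forall>p. multihomogeneous V E p \<longrightarrow> W \<subseteq> zero_locus V E p \<longrightarrow> P \<in> zero_locus V E p}"

lemma subset_zero_closure: "W \<subseteq> zero_closure W"
  by (auto simp: zero_closure_def)

lemma irreducible_locusD:
  "irreducible_locus Z \<Longrightarrow> multihomogeneous V E p \<Longrightarrow> multihomogeneous V E q \<Longrightarrow>
    Z \<subseteq> zero_locus V E p \<union> zero_locus V E q \<Longrightarrow> Z \<subseteq> zero_locus V E p \<or> Z \<subseteq> zero_locus V E q"
  unfolding irreducible_locus_def by blast

text \<open>Used to single out one chart among the finitely many that cover a cellule.\<close>

lemma irreducible_locus_prod:
  assumes "irreducible_locus Z" "finite A" "\<And>x. x \<in> A \<Longrightarrow> multihomogeneous V E (p x)"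
    "Z \<subseteq> zero_locus V E (prod p A)"
  shows "\<exists>x\<in>A. Z \<subseteq> zero_locus V E (p x)"
  using assms(2,3,4)
proof (induction A rule: finite_induct)
  case empty
  then show ?case using assms(1) by (auto simp: zero_locus_one irreducible_locus_def)
next
  case (insert x A)
  then have "Z \<subseteq> zero_locus V E (p x) \<union> zero_locus V E (prod p A)"
    by (simp add: zero_locus_mult multihomogeneous_prod)
  then have "Z \<subseteq> zero_locus V E (p x) \<or> Z \<subseteq> zero_locus V E (prod p A)"
    using insert by (intro irreducible_locusD[OF assms(1)] multihomogeneous_prod) auto
  then show ?case using insert by auto
qed

abbreviation sub_topology :: "('a::field, 'n::finite, 'v) picture set \<Rightarrow> ('a, 'n, 'v) picture topology" where
  "sub_topology X \<equiv> subtopology (picture_topology V E) X"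

lemma closedin_sub_topology:
  assumes "X \<subseteq> picture_space V E"
  shows "closedin (sub_topology X) Z \<longleftrightarrow> (\<exists>C. closedin (zariski_topology V E) C \<and> Z = X \<inter> C)"
proof -
  have "sub_topology X = subtopology (zariski_topology V E) X"
    unfolding picture_topology_def subtopology_subtopology using assms by (simp add: Int_absorb1)
  then show ?thesis by (simp add: closedin_subtopology Int_commute)
qed

lemma closedin_zero_locus_Int:
  assumes "X \<subseteq> picture_space V E" "multihomogeneous V E p"
  shows "closedin (sub_topology X) (X \<inter> zero_locus V E p)"
  using assms closedin_sub_topology closedin_zero_locus by blast

text \<open>Supplies the polynomial witnessing a strict inclusion in a chain of closed sets.\<close>

lemma closedin_separation:
  assumes X: "X \<subseteq> picture_space V E" and Z: "closedin (sub_topology X) Z" and P: "P \<in> X - Z"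
  shows "\<exists>p. multihomogeneous V E p \<and> Z \<subseteq> zero_locus V E p \<and> P \<notin> zero_locus V E p"
proof -
  obtain C where C: "closedin (zariski_topology V E) C" "Z = X \<inter> C"
    using closedin_sub_topology[OF X] Z by blast
  then have "openin (zariski_topology V E) (ambient_space V E - C)"
    by (metis closedin_def topspace_zariski_topology)
  moreover have "P \<in> ambient_space V E - C"
    using P C X picture_space_subset by blast
  ultimately obtain p where "multihomogeneous V E p" "P \<in> ambient_space V E - zero_locus V E p"
    "ambient_space V E - zero_locus V E p \<subseteq> ambient_space V E - C"
    using zariski_open_separation by blast
  then show ?thesis using C X picture_space_subset by (intro exI[of _ p]) blast
qed

text \<open>If two closed sets each miss a point of \<open>Z\<close>, they can be enlarged to zero
  loci of single polynomials that still miss these points. Hence pairs of polynomials suffice as a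
  test.\<close>

lemma irreducible_in_sub_topology_iff:
  assumes X: "X \<subseteq> picture_space V E"
  shows "irreducible_in (sub_topology X) Z \<longleftrightarrow> Z \<subseteq> X \<and> irreducible_locus Z"
proof -
  have top: "topspace (sub_topology X) = X"
    using X by (auto simp: topspace_picture_topology)
  show ?thesis
  proof
    assume irr: "irreducible_in (sub_topology X) Z"
    then have ZX: "Z \<subseteq> X" and ne: "Z \<noteq> {}"
      using top by (auto simp: irreducible_in_def)
    have "Z \<subseteq> zero_locus V E p \<or> Z \<subseteq> zero_locus V E q"
      if "multihomogeneous V E p" "multihomogeneous V E q" "Z \<subseteq> zero_locus V E p \<union> zero_locus V E q" for p q
    proof -
      have "Z \<subseteq> X \<inter> zero_locus V E p \<or> Z \<subseteq> X \<inter> zero_locus V E q"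
        using irr closedin_zero_locus_Int[OF X that(1)] closedin_zero_locus_Int[OF X that(2)] that(3) ZX
        unfolding irreducible_in_def Int_Un_distrib[symmetric] by (metis Int_Un_distrib le_inf_iff)
      then show ?thesis by blast
    qed
    then show "Z \<subseteq> X \<and> irreducible_locus Z"
      using ZX ne X picture_space_subset unfolding irreducible_locus_def by blast
  next
    assume Z: "Z \<subseteq> X \<and> irreducible_locus Z"
    have "Z \<subseteq> A \<or> Z \<subseteq> B" if AB: "closedin (sub_topology X) A" "closedin (sub_topology X) B" "Z \<subseteq> A \<union> B" for A B
    proof (rule ccontr)
      assume "\<not> (Z \<subseteq> A \<or> Z \<subseteq> B)"
      then obtain P Q where PQ: "P \<in> Z" "P \<notin> A" "Q \<in> Z" "Q \<notin> B" by blast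
      obtain p where p: "multihomogeneous V E p" "A \<subseteq> zero_locus V E p" "P \<notin> zero_locus V E p"
        using closedin_separation[OF X AB(1)] PQ Z by blast
      obtain q where q: "multihomogeneous V E q" "B \<subseteq> zero_locus V E q" "Q \<notin> zero_locus V E q"
        using closedin_separation[OF X AB(2)] PQ Z by blast
      have "Z \<subseteq> zero_locus V E p \<union> zero_locus V E q" using AB p q by blast
      then show False using Z p q PQ unfolding irreducible_locus_def by blast
    qed
    then show "irreducible_in (sub_topology X) Z"
      using Z top unfolding irreducible_in_def irreducible_locus_def by auto
  qed
qed

text \<open>A polynomial that vanishes on \<open>W\<close> vanishes on its closure, so a cover of
  the closure by two loci is decided on \<open>W\<close>.\<close>

lemma zero_closure_irreducible:
  assumes "irreducible_locus W" "W \<subseteq> X" "X \<subseteq> ambient_space V E"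
  shows "irreducible_locus (X \<inter> zero_closure W)"
  unfolding irreducible_locus_def
proof (intro conjI allI impI)
  have W: "W \<subseteq> X \<inter> zero_closure W"
    using assms subset_zero_closure by blast
  then show "X \<inter> zero_closure W \<noteq> {}"
    using assms(1) by (auto simp: irreducible_locus_def)
  show "X \<inter> zero_closure W \<subseteq> ambient_space V E"
    using assms(3) by blast
  fix p q
  assume pq: "multihomogeneous V E p" "multihomogeneous V E q"
    and sub: "X \<inter> zero_closure W \<subseteq> zero_locus V E p \<union> zero_locus V E q"
  have "W \<subseteq> zero_locus V E p \<or> W \<subseteq> zero_locus V E q"
    using irreducible_locusD[OF assms(1) pq] W sub by (meson order_trans)
  then show "X \<inter> zero_closure W \<subseteq> zero_locus V E p \<or> X \<inter> zero_closure W \<subseteq> zero_locus V E q"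
  proof
    assume "W \<subseteq> zero_locus V E p"
    then have "zero_closure W \<subseteq> zero_locus V E p" using pq by (auto simp: zero_closure_def)
    then show ?thesis by blast
  next
    assume "W \<subseteq> zero_locus V E q"
    then have "zero_closure W \<subseteq> zero_locus V E q" using pq by (auto simp: zero_closure_def)
    then show ?thesis by blast
  qed
qed

lemma zero_closure_closedin:
  fixes X :: "('a::field, 'n::finite, 'v) picture set"
  assumes X: "X \<subseteq> picture_space V E"
  shows "closedin (sub_topology X) (X \<inter> zero_closure W)"
proof -
  let ?F = "{X \<inter> zero_locus V E p | p :: ('a, 'n, 'v) picture_poly. multihomogeneous V E p \<and> W \<subseteq> zero_locus V E p}"
  have "closedin (sub_topology X) (\<Inter>(insert X ?F))"
  proof (rule closedin_Inter)
    fix S assume "S \<in> insert X ?F"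
    moreover have "closedin (sub_topology X) X"
      using closedin_topspace[of "sub_topology X"] X by (simp add: topspace_picture_topology Int_absorb1)
    ultimately show "closedin (sub_topology X) S"
      using closedin_zero_locus_Int[OF X] by blast
  qed auto
  moreover have "\<Inter>(insert X ?F) = X \<inter> zero_closure W"
    by (auto simp: zero_closure_def)
  ultimately show ?thesis by simp
qed

end

section \<open>Charts of a cellule\<close>

context finite_config
begin

text \<open>The partition is given by the fibres of a labelling \<open>r\<close>; the constant
  labelling gives the indiscrete cellule.\<close>

definition cellule_of :: "('v \<Rightarrow> 'r) \<Rightarrow> ('a::field, 'n::finite, 'v) picture set" where
  "cellule_of r = {P \<in> picture_space V E. \<forall>v\<in>V. \<forall>w\<in>V. fst P v = fst P w \<longleftrightarrow> r v = r w}"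

lemma cellule_of_subset: "cellule_of r \<subseteq> picture_space V E"
  by (auto simp: cellule_of_def)

lemma cellule_of_subset_ambient: "cellule_of r \<subseteq> ambient_space V E"
  using cellule_of_subset picture_space_subset by blast

end

text \<open>A cellule is described by the map \<open>r\<close> sending a vertex to (a label of) its block. In a chart, the point of the
  block \<open>\<rho>\<close> is normalized to have coordinate 1 at the index \<open>i0 \<rho>\<close>. A line joining different blocks is then
  determined; a line of an edge \<open>e\<close> inside a block is spanned by the point and a direction with
  coordinate 0 at \<open>i0\<close> and 1 at \<open>i1 e\<close>. All remaining coordinates are free parameters.\<close>

locale chart = finite_config V E for V :: "'v set" and E :: "'v set set" +
  fixes r :: "'v \<Rightarrow> 'r" and i0 :: "'r \<Rightarrow> 'n::finite" and i1 :: "'v set \<Rightarrow> 'n"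
    and a1 a2 :: "'v set \<Rightarrow> 'v"
  assumes edge: "e \<in> E \<Longrightarrow> e = {a1 e, a2 e}" "e \<in> E \<Longrightarrow> a1 e \<in> V" "e \<in> E \<Longrightarrow> a2 e \<in> V"
    and i1: "e \<in> E \<Longrightarrow> i1 e \<noteq> i0 (r (a1 e))"
begin

definition inner :: "'v set set" where
  "inner = {e \<in> E. r (a1 e) = r (a2 e)}"

definition params :: "('r \<times> 'n + 'v set \<times> 'n) set" where
  "params = (SIGMA \<rho>:r ` V. - {i0 \<rho>}) <+> (SIGMA e:inner. - {i0 (r (a1 e)), i1 e})"

definition pt :: "(('r \<times> 'n + 'v set \<times> 'n) \<Rightarrow> 'a::field) \<Rightarrow> 'r \<Rightarrow> 'a ^ 'n" where
  "pt t \<rho> = (\<chi> i. if i = i0 \<rho> then 1 else t (Inl (\<rho>, i)))"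

definition dir :: "(('r \<times> 'n + 'v set \<times> 'n) \<Rightarrow> 'a::field) \<Rightarrow> 'v set \<Rightarrow> 'a ^ 'n" where
  "dir t e = (\<chi> i. if i = i0 (r (a1 e)) then 0 else if i = i1 e then 1 else t (Inr (e, i)))"

definition snd_pt :: "(('r \<times> 'n + 'v set \<times> 'n) \<Rightarrow> 'a::field) \<Rightarrow> 'v set \<Rightarrow> 'a ^ 'n" where
  "snd_pt t e = (if e \<in> inner then dir t e else pt t (r (a2 e)))"

text \<open>The value 0 off the graph makes every coordinate, without exception, a polynomial
  function of the parameters, as \<open>poly_eval_in_poly_funs\<close> demands.\<close>

definition crd :: "(('r \<times> 'n + 'v set \<times> 'n) \<Rightarrow> 'a::field) \<Rightarrow> ('n, 'v) coord \<Rightarrow> 'a" where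
  "crd t x = (case x of PointCoord v i \<Rightarrow> if v \<in> V then pt t (r v) $ i else 0
    | LineCoord e i j \<Rightarrow> if e \<in> E then minor (pt t (r (a1 e))) (snd_pt t e) i j else 0)"

definition pic :: "(('r \<times> 'n + 'v set \<times> 'n) \<Rightarrow> 'a::field) \<Rightarrow> ('a, 'n, 'v) picture" where
  "pic t = (\<lambda>v\<in>V. vec.span {pt t (r v)}, \<lambda>e\<in>E. vec.span {pt t (r (a1 e)), snd_pt t e})"

text \<open>The open condition that different blocks receive different points. It also ensures that
  the two vectors chosen for an edge between blocks span a line.\<close>

definition good :: "(('r \<times> 'n + 'v set \<times> 'n) \<Rightarrow> 'a::field) \<Rightarrow> bool" where
  "good t \<longleftrightarrow> (\<forall>\<rho>\<in>r ` V. \<forall>\<rho>'\<in>r ` V. \<rho> \<noteq> \<rho>' \<longrightarrow> (\<exists>i j. minor (pt t \<rho>) (pt t \<rho>') i j \<noteq> 0))"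

lemma edge_cases: "e \<in> E \<Longrightarrow> v \<in> e \<Longrightarrow> v = a1 e \<or> v = a2 e"
  using edge(1) by blast

lemma edge_ends: "e \<in> E \<Longrightarrow> a1 e \<in> e" "e \<in> E \<Longrightarrow> a2 e \<in> e"
  using edge(1) by blast+

lemma edge_subset: "e \<in> E \<Longrightarrow> v \<in> e \<Longrightarrow> v \<in> V"
  using edge_cases edge(2,3) by blast

lemma inner_subset: "inner \<subseteq> E"
  by (auto simp: inner_def)

lemma finite_params: "finite params"
  unfolding params_def using finite_V finite_subset[OF inner_subset finite_E]
  by (intro finite_Plus finite_SigmaI) auto

text \<open>The indices \<open>i0\<close> and \<open>i1\<close> have dropped out of the count, so
  all charts for the same \<open>r\<close>, \<open>a1\<close> and \<open>a2\<close> have the same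
  number of parameters.\<close>

lemma card_params: "card params = card (r ` V) * (CARD('n) - 1) + card inner * (CARD('n) - 2)"
proof -
  have "finite inner" using inner_subset finite_E finite_subset by blast
  moreover have "card (- {i0 \<rho>}) = CARD('n) - 1" for \<rho>
    by (simp add: Compl_eq_Diff_UNIV card_Diff_subset)
  moreover have "card (- {i0 (r (a1 e)), i1 e}) = CARD('n) - 2" if "e \<in> inner" for e
    using i1[of e] that inner_subset by (auto simp: Compl_eq_Diff_UNIV card_Diff_subset)
  ultimately show ?thesis
    unfolding params_def using finite_V by (simp add: card_Plus finite_SigmaI)
qed

lemma pt_nonzero [simp]: "pt t \<rho> \<noteq> 0"
  by (auto simp: pt_def vec_eq_iff)

text \<open>At the index \<open>i0\<close> the point has entry 1 and the direction entry 0. So this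
  row of Pluecker coordinates is the direction itself, and its parameters can be read off the
  line.\<close>

lemma minor_pt_dir: "e \<in> E \<Longrightarrow> minor (pt t (r (a1 e))) (dir t e) (i0 (r (a1 e))) j = dir t e $ j"
  by (simp add: minor_def pt_def dir_def)

lemma minor_snd_pt:
  assumes "good t" "e \<in> E"
  shows "\<exists>i j. minor (pt t (r (a1 e))) (snd_pt t e) i j \<noteq> 0"
proof (cases "e \<in> inner")
  case True
  have "minor (pt t (r (a1 e))) (dir t e) (i0 (r (a1 e))) (i1 e) \<noteq> 0"
    using i1[OF assms(2)] by (simp add: minor_pt_dir[OF assms(2)]) (simp add: dir_def)
  then show ?thesis using True by (auto simp: snd_pt_def)
next
  case False
  then show ?thesis using assms edge(2,3) by (auto simp: snd_pt_def good_def inner_def)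
qed

lemma pic_in_cellule:
  assumes "good t"
  shows "pic t \<in> cellule_of r"
proof -
  have amb: "pic t \<in> ambient_space V E"
    using minor_snd_pt[OF assms] unfolding pic_def ambient_space_def
    by (auto intro!: span_singleton_proj_point restrict_PiE) (metis span_pair_proj_line)
  have "fst (pic t) v \<subseteq> snd (pic t) e" if e: "e \<in> E" and v: "v \<in> e" for e v
  proof -
    have vV: "v \<in> V" and v': "v = a1 e \<or> v = a2 e"
      using edge_subset[OF e v] edge_cases[OF e v] by auto
    then have "r v = r (a1 e) \<or> snd_pt t e = pt t (r v)"
      using e by (auto simp: snd_pt_def inner_def)
    then have "pt t (r v) \<in> {pt t (r (a1 e)), snd_pt t e}" by auto
    then have "vec.span {pt t (r v)} \<subseteq> vec.span {pt t (r (a1 e)), snd_pt t e}"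
      by (intro vec.span_mono) auto
    then show ?thesis using vV e by (simp add: pic_def)
  qed
  moreover have "fst (pic t) v = fst (pic t) w \<longleftrightarrow> r v = r w" if "v \<in> V" "w \<in> V" for v w
  proof
    assume "fst (pic t) v = fst (pic t) w"
    then have "\<forall>i j. minor (pt t (r v)) (pt t (r w)) i j = 0"
      using that by (simp add: pic_def span_singleton_eq_iff_minors)
    then show "r v = r w" using assms that unfolding good_def by blast
  qed (use that in \<open>simp add: pic_def\<close>)
  ultimately show ?thesis using amb by (simp add: cellule_of_def picture_space_def)
qed

lemma coordinates_of_pic: "coordinates_of V E (pic t) (crd t)"
  unfolding coordinates_of_def
proof (intro conjI ballI)
  fix v assume "v \<in> V"
  then show "\<exists>x. vec.span {x} = fst (pic t) v \<and> (\<forall>i. crd t (PointCoord v i) = x $ i)"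
    by (intro exI[of _ "pt t (r v)"]) (simp add: pic_def crd_def)
next
  fix e assume "e \<in> E"
  then show "\<exists>x y. vec.span {x, y} = snd (pic t) e \<and> (\<forall>i j. crd t (LineCoord e i j) = x $ i * y $ j - x $ j * y $ i)"
    by (intro exI[of _ "pt t (r (a1 e))"] exI[of _ "snd_pt t e"]) (simp add: pic_def crd_def minor_def)
qed

lemma pic_zero_locus_iff:
  assumes "multihomogeneous V E p" "good t"
  shows "pic t \<in> zero_locus V E p \<longleftrightarrow> poly_eval (crd t) p = 0"
  using assms(1) pic_in_cellule[OF assms(2)] cellule_of_subset_ambient
  by (intro zero_locus_iff coordinates_of_pic) auto

text \<open>The parameters are the entries of the normalized vectors. Each line of \<open>P\<close>
  contains the two independent vectors that span the corresponding line of \<open>pic t\<close>, so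
  the lines agree for dimension reasons.\<close>

lemma pic_surj:
  assumes P: "P \<in> cellule_of r"
    and x: "\<And>\<rho>. \<rho> \<in> r ` V \<Longrightarrow> x \<rho> $ i0 \<rho> = 1" "\<And>v. v \<in> V \<Longrightarrow> fst P v = vec.span {x (r v)}"
    and y: "\<And>e. e \<in> inner \<Longrightarrow> y e \<in> snd P e \<and> y e $ i0 (r (a1 e)) = 0 \<and> y e $ i1 e = 1"
  shows "\<exists>t. good t \<and> pic t = P"
proof -
  define t where "t j = (case j of Inl (\<rho>, i) \<Rightarrow> x \<rho> $ i | Inr (e, i) \<Rightarrow> y e $ i)" for j
  have pt: "pt t \<rho> = x \<rho>" if "\<rho> \<in> r ` V" for \<rho>
    using x(1)[OF that] by (auto simp: pt_def vec_eq_iff t_def)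
  have dir: "dir t e = y e" if "e \<in> inner" for e
    using y[OF that] by (auto simp: dir_def vec_eq_iff t_def)
  have amb: "P \<in> ambient_space V E" using P cellule_of_subset_ambient by blast
  have good: "good t"
    unfolding good_def
  proof (intro ballI impI)
    fix \<rho> \<rho>' assume \<rho>: "\<rho> \<in> r ` V" "\<rho>' \<in> r ` V" "\<rho> \<noteq> \<rho>'"
    then obtain v w where vw: "v \<in> V" "w \<in> V" "\<rho> = r v" "\<rho>' = r w" by blast
    then have "vec.span {pt t \<rho>} \<noteq> vec.span {pt t \<rho>'}"
      using P \<rho> pt x(2) by (auto simp: cellule_of_def)
    then show "\<exists>i j. minor (pt t \<rho>) (pt t \<rho>') i j \<noteq> 0"
      by (simp add: span_singleton_eq_iff_minors)
  qed
  have "fst (pic t) = fst P"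
  proof
    fix v show "fst (pic t) v = fst P v"
    proof (cases "v \<in> V")
      case True
      then show ?thesis using x pt by (simp add: pic_def)
    next
      case False
      then show ?thesis using amb by (auto simp: pic_def ambient_space_def PiE_def extensional_def)
    qed
  qed
  moreover have "snd (pic t) = snd P"
  proof
    fix e show "snd (pic t) e = snd P e"
    proof (cases "e \<in> E")
      case True
      have inc: "pt t (r v) \<in> snd P e" if "v \<in> e" for v
      proof -
        have "v \<in> V" using edge_subset[OF True that] .
        then have "pt t (r v) \<in> fst P v" using x(2) pt by (auto intro: vec.span_base)
        moreover have "fst P v \<subseteq> snd P e"
          using P True that by (auto simp: cellule_of_def picture_space_def)
        ultimately show ?thesis by blast
      qed
      have "a1 e \<in> e" "a2 e \<in> e" using edge_ends[OF True] by auto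
      then have "pt t (r (a1 e)) \<in> snd P e" "snd_pt t e \<in> snd P e"
        using inc y dir by (auto simp: snd_pt_def)
      moreover obtain i j where "minor (pt t (r (a1 e))) (snd_pt t e) i j \<noteq> 0"
        using minor_snd_pt[OF good True] by blast
      moreover have "vec.subspace (snd P e)" "vec.dim (snd P e) = 2"
        using ambient_space_line[OF amb True] by (auto simp: proj_lines_def)
      ultimately show ?thesis using True by (simp add: pic_def span_pair_eqI)
    next
      case False
      then show ?thesis using amb by (auto simp: pic_def ambient_space_def PiE_def extensional_def)
    qed
  qed
  ultimately show ?thesis using good by (metis prod_eqI)
qed

section \<open>Charts as polynomial maps\<close>

lemma pt_poly_fun:
  assumes "\<rho> \<in> r ` V"
  shows "(\<lambda>t :: _ \<Rightarrow> 'a::field. pt t \<rho> $ i) \<in> poly_funs params 1"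
proof (cases "i = i0 \<rho>")
  case True
  then show ?thesis using poly_funs_const by (simp add: pt_def)
next
  case False
  then have "Inl (\<rho>, i) \<in> params" using assms by (auto simp: params_def)
  then show ?thesis
    using poly_funs_var[OF finite_params, of "Inl (\<rho>, i)"] False by (simp add: pt_def)
qed

lemma dir_poly_fun:
  assumes "e \<in> inner"
  shows "(\<lambda>t :: _ \<Rightarrow> 'a::field. dir t e $ i) \<in> poly_funs params 1"
proof (cases "i = i0 (r (a1 e)) \<or> i = i1 e")
  case True
  then have "(\<lambda>t :: _ \<Rightarrow> 'a. dir t e $ i) = (\<lambda>t. if i = i0 (r (a1 e)) then 0 else 1)"
    by (auto simp: dir_def)
  then show ?thesis
    using poly_funs_const by metis
next
  case False
  then have "Inr (e, i) \<in> params" using assms by (auto simp: params_def)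
  then show ?thesis
    using poly_funs_var[OF finite_params, of "Inr (e, i)"] False by (simp add: dir_def)
qed

lemma minor_poly_fun:
  assumes "\<And>i. (\<lambda>t. x t $ i) \<in> poly_funs params 1" "\<And>i. (\<lambda>t. y t $ i) \<in> poly_funs params 1"
  shows "(\<lambda>t :: _ \<Rightarrow> 'a::field. minor (x t) (y t) i j) \<in> poly_funs params 2"
proof -
  have "(\<lambda>t. minor (x t) (y t) i j) \<in> poly_funs params (1 + 1)"
    unfolding minor_def by (intro poly_funs_diff poly_funs_mult assms)
  then show ?thesis by (simp add: numeral_2_eq_2)
qed

lemma crd_poly_fun: "(\<lambda>t :: _ \<Rightarrow> 'a::field. crd t x) \<in> poly_funs params 2"
proof (cases x)
  case (PointCoord v i)
  show ?thesis
  proof (cases "v \<in> V")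
    case True
    then show ?thesis
      using poly_funs_mono[OF pt_poly_fun[of "r v" i], of 2] by (simp add: crd_def PointCoord)
  next
    case False
    then show ?thesis using poly_funs.zero by (simp add: crd_def PointCoord)
  qed
next
  case (LineCoord e i j)
  show ?thesis
  proof (cases "e \<in> E")
    case True
    have "(\<lambda>t :: _ \<Rightarrow> 'a. snd_pt t e $ i) \<in> poly_funs params 1" for i
      using dir_poly_fun[of e i] pt_poly_fun[of "r (a2 e)" i] edge(3)[OF True]
      by (cases "e \<in> inner") (auto simp: snd_pt_def)
    then have "(\<lambda>t :: _ \<Rightarrow> 'a. minor (pt t (r (a1 e))) (snd_pt t e) i j) \<in> poly_funs params 2"
      using pt_poly_fun[of "r (a1 e)"] edge(2)[OF True] by (intro minor_poly_fun) auto
    then show ?thesis using True by (simp add: crd_def LineCoord)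
  next
    case False
    then show ?thesis using poly_funs.zero by (simp add: crd_def LineCoord)
  qed
qed

lemma eval_crd_poly_fun:
  fixes p :: "('a::field, 'n, 'v) picture_poly"
  shows "\<exists>K. (\<lambda>t. poly_eval (crd t) p) \<in> poly_funs params K"
  using poly_eval_in_poly_funs[OF crd_poly_fun] .

text \<open>For each of the finitely many pairs of different labels, one minor that is nonzero at
  \<open>l0\<close> stays nonzero for all but finitely many \<open>l\<close>.\<close>

lemma not_good_on_line_finite:
  fixes s t :: "_ \<Rightarrow> 'a::field"
  assumes "good (\<lambda>j. s j + l0 * (t j - s j))"
  shows "finite {l. \<not> good (\<lambda>j. s j + l * (t j - s j))}"
proof -
  let ?u = "\<lambda>l j. s j + l * (t j - s j)"
  let ?D = "{(\<rho>, \<rho>'). \<rho> \<in> r ` V \<and> \<rho>' \<in> r ` V \<and> \<rho> \<noteq> \<rho>'}"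
  let ?bad = "\<lambda>(\<rho>, \<rho>'). {l. \<forall>i j. minor (pt (?u l) \<rho>) (pt (?u l) \<rho>') i j = 0}"
  have "finite (?bad d)" if d: "d \<in> ?D" for d
  proof -
    obtain \<rho> \<rho>' where d': "d = (\<rho>, \<rho>')" "\<rho> \<in> r ` V" "\<rho>' \<in> r ` V" "\<rho> \<noteq> \<rho>'"
      using d by blast
    then obtain i j where ij: "minor (pt (?u l0) \<rho>) (pt (?u l0) \<rho>') i j \<noteq> 0"
      using assms unfolding good_def by blast
    have "(\<lambda>t :: _ \<Rightarrow> 'a. minor (pt t \<rho>) (pt t \<rho>') i j) \<in> poly_funs params 2"
      using d' by (intro minor_poly_fun pt_poly_fun)
    from poly_fun_zeros_on_line_finite[OF this ij]
    have "finite {l. minor (pt (?u l) \<rho>) (pt (?u l) \<rho>') i j = 0}" .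
    then show ?thesis by (rule rev_finite_subset) (auto simp: d')
  qed
  moreover have "finite ?D"
    by (rule finite_subset[of _ "r ` V \<times> r ` V"]) (use finite_V in auto)
  ultimately have "finite (\<Union>d\<in>?D. ?bad d)" by blast
  then show ?thesis by (rule rev_finite_subset) (auto simp: good_def)
qed

text \<open>Parameters of a picture off the first locus and of one off the second are joined by a
  line, almost every point of which is good and avoids both loci. Closure of \<open>L\<close> under
  lines covers the full parameter space as well as the coordinate subspaces of
  \<open>krull_dim_cellule_ge\<close>.\<close>

lemma chart_irreducible:
  fixes L :: "(_ \<Rightarrow> 'a::alg_closed_field) set"
  assumes L: "\<And>s t l. s \<in> L \<Longrightarrow> t \<in> L \<Longrightarrow> (\<lambda>j. s j + l * (t j - s j)) \<in> L"
    and ne: "c \<in> L" "good c"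
  shows "irreducible_locus (pic ` {t \<in> L. good t})"
  unfolding irreducible_locus_def
proof (intro conjI allI impI)
  let ?W = "pic ` {t \<in> L. good t}"
  show "?W \<noteq> {}" using ne by blast
  show "?W \<subseteq> ambient_space V E"
    using pic_in_cellule cellule_of_subset_ambient by blast
  fix p q :: "('a, 'n, 'v) picture_poly"
  assume pq: "multihomogeneous V E p" "multihomogeneous V E q"
    and sub: "?W \<subseteq> zero_locus V E p \<union> zero_locus V E q"
  show "?W \<subseteq> zero_locus V E p \<or> ?W \<subseteq> zero_locus V E q"
  proof (rule ccontr)
    assume "\<not> (?W \<subseteq> zero_locus V E p \<or> ?W \<subseteq> zero_locus V E q)"
    then obtain s t where s: "s \<in> L" "good s" "pic s \<notin> zero_locus V E p"
      and t: "t \<in> L" "good t" "pic t \<notin> zero_locus V E q" by blast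
    \<comment> \<open>The line is at \<open>s\<close> for \<open>l = 0\<close> and at
      \<open>t\<close> for \<open>l = 1\<close>, which are the witnesses of nonvanishing
      below.\<close>
    let ?u = "\<lambda>l j. s j + l * (t j - s j)"
    obtain K where "(\<lambda>t. poly_eval (crd t) p) \<in> poly_funs params K"
      using eval_crd_poly_fun by blast
    then have "finite {l. poly_eval (crd (?u l)) p = 0}"
      using s pq by (intro poly_fun_zeros_on_line_finite[of _ _ _ _ 0]) (auto simp: pic_zero_locus_iff)
    moreover obtain K' where "(\<lambda>t. poly_eval (crd t) q) \<in> poly_funs params K'"
      using eval_crd_poly_fun by blast
    then have "finite {l. poly_eval (crd (?u l)) q = 0}"
      using t pq by (intro poly_fun_zeros_on_line_finite[of _ _ _ _ 1]) (auto simp: pic_zero_locus_iff)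
    moreover have "finite {l. \<not> good (?u l)}"
      using s by (intro not_good_on_line_finite[of _ 0]) auto
    ultimately have "finite ({l. poly_eval (crd (?u l)) p = 0} \<union> {l. poly_eval (crd (?u l)) q = 0} \<union> {l. \<not> good (?u l)})"
      by (intro finite_UnI)
    from ex_new_if_finite[OF infinite_UNIV_alg_closed_field this]
    obtain l where "l \<notin> {l. poly_eval (crd (?u l)) p = 0} \<union> {l. poly_eval (crd (?u l)) q = 0} \<union> {l. \<not> good (?u l)}"
      by (rule exE)
    then have l: "poly_eval (crd (?u l)) p \<noteq> 0" "poly_eval (crd (?u l)) q \<noteq> 0" "good (?u l)"
      by auto
    have "pic (?u l) \<in> ?W" using L s t l by blast
    moreover have "pic (?u l) \<notin> zero_locus V E p" "pic (?u l) \<notin> zero_locus V E q"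
      using l pic_zero_locus_iff[OF pq(1) l(3)] pic_zero_locus_iff[OF pq(2) l(3)] by auto
    ultimately show False using sub by blast
  qed
qed

text \<open>A parameter is a ratio of two coordinates of the same point or the same line, with
  denominator normalized to 1. Hence fixing its value is a homogeneous linear equation.\<close>

lemma param_locus:
  assumes "j \<in> params"
  shows "\<exists>p :: ('a::field, 'n, 'v) picture_poly. multihomogeneous V E p \<and>
    (\<forall>t. good t \<longrightarrow> pic t \<in> zero_locus V E p \<longleftrightarrow> t j = c)"
proof -
  have "\<exists>p :: ('a, 'n, 'v) picture_poly. multihomogeneous V E p \<and> (\<forall>t. poly_eval (crd t) p = t j - c)"
  proof (cases j)
    case (Inl z)
    then obtain v i where z: "z = (r v, i)" "v \<in> V" "i \<noteq> i0 (r v)"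
      using assms by (auto simp: params_def)
    let ?p = "poly_var (PointCoord v i) + poly_const (-c) * poly_var (PointCoord v (i0 (r v)))
      :: ('a, 'n, 'v) picture_poly"
    have "has_multidegree V E (\<lambda>w. if w = v then 1 else 0) (\<lambda>_. 0) ?p"
      using has_multidegree_mult[OF has_multidegree_const has_multidegree_point_var[OF z(2)]]
      by (intro has_multidegree_add has_multidegree_point_var z) simp
    moreover have "poly_eval (crd t) ?p = t j - c" for t
      using z Inl by (simp add: crd_def pt_def)
    ultimately show ?thesis unfolding multihomogeneous_iff by blast
  next
    case (Inr z)
    then obtain e i where z: "z = (e, i)" "e \<in> inner" "i \<noteq> i0 (r (a1 e))" "i \<noteq> i1 e"
      using assms by (auto simp: params_def)
    then have e: "e \<in> E" using inner_subset by blast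
    let ?p = "poly_var (LineCoord e (i0 (r (a1 e))) i) +
      poly_const (-c) * poly_var (LineCoord e (i0 (r (a1 e))) (i1 e)) :: ('a, 'n, 'v) picture_poly"
    have "has_multidegree V E (\<lambda>_. 0) (\<lambda>f. if f = e then 1 else 0) ?p"
      using has_multidegree_mult[OF has_multidegree_const has_multidegree_line_var[OF e]]
      by (intro has_multidegree_add has_multidegree_line_var e) simp
    moreover have "poly_eval (crd t) ?p = t j - c" for t
      using z Inr e i1[OF e] by (simp add: crd_def snd_pt_def minor_pt_dir) (simp add: dir_def)
    ultimately show ?thesis unfolding multihomogeneous_iff by blast
  qed
  then show ?thesis using pic_zero_locus_iff by (metis right_minus_eq)
qed

text \<open>The chain consists of the closures of the images of a flag of coordinate subspaces
  through \<open>c\<close>.\<close>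

lemma krull_dim_cellule_ge:
  fixes c :: "_ \<Rightarrow> 'a::alg_closed_field"
  assumes "good c"
  shows "ereal (real (card params)) \<le>
    krull_dim (sub_topology (cellule_of r :: ('a, 'n, 'v) picture set))"
proof -
  let ?X = "cellule_of r :: ('a, 'n, 'v) picture set"
  define N where "N = card params"
  obtain h where h: "bij_betw h {..<N} params"
    unfolding N_def using ex_bij_betw_nat_finite[OF finite_params] by (auto simp: atLeast0LessThan)
  \<comment> \<open>In \<open>L k\<close> the parameters \<open>h 0\<close>, ...,
    \<open>h (k - 1)\<close> are free and the later ones keep their values from
    \<open>c\<close>.\<close>
  define L where "L k = {t. \<forall>m<N. m \<ge> k \<longrightarrow> t (h m) = c (h m)}" for k
  define W where "W k = pic ` {t \<in> L k. good t}" for k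
  define Z where "Z k = ?X \<inter> zero_closure (W k)" for k
  have WX: "W k \<subseteq> ?X" for k
    using pic_in_cellule by (auto simp: W_def)
  have WZ: "W k \<subseteq> Z k" for k
    using WX subset_zero_closure by (auto simp: Z_def)
  have irr: "irreducible_locus (W k)" for k
    unfolding W_def by (rule chart_irreducible[of _ c]) (auto simp: L_def assms)
  have 1: "closedin (sub_topology ?X) (Z k) \<and> irreducible_in (sub_topology ?X) (Z k)" for k
    unfolding Z_def
    by (simp add: zero_closure_closedin[OF cellule_of_subset] irreducible_in_sub_topology_iff[OF cellule_of_subset]
        zero_closure_irreducible[OF irr WX cellule_of_subset_ambient])
  have 2: "Z k \<subset> Z (Suc k)" if k: "k < N" for k
  proof
    have "W k \<subseteq> W (Suc k)" by (auto simp: W_def L_def)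
    then show "Z k \<subseteq> Z (Suc k)" unfolding Z_def zero_closure_def by blast
    have "h k \<in> params" using h k by (auto simp: bij_betw_def)
    then obtain p :: "('a, 'n, 'v) picture_poly" where p: "multihomogeneous V E p"
      "\<And>t. good t \<Longrightarrow> pic t \<in> zero_locus V E p \<longleftrightarrow> t (h k) = c (h k)"
      using param_locus by blast
    have "W k \<subseteq> zero_locus V E p" using p k by (auto simp: W_def L_def)
    then have Zk: "Z k \<subseteq> zero_locus V E p" using p by (auto simp: Z_def zero_closure_def)
    \<comment> \<open>Moving from \<open>c\<close> towards \<open>d\<close> changes only the
      parameter \<open>h k\<close>. Almost every such move is good, and every nonzero one leaves the
      locus that contains \<open>Z k\<close>.\<close>
    define d where "d = c(h k := c (h k) + 1)"
    have "finite ({l. \<not> good (\<lambda>j. c j + l * (d j - c j))} \<union> {0})"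
      using not_good_on_line_finite[of c 0 d] assms by simp
    from ex_new_if_finite[OF infinite_UNIV_alg_closed_field this]
    obtain l where "l \<notin> {l. \<not> good (\<lambda>j. c j + l * (d j - c j))} \<union> {0}"
      by (rule exE)
    then have l: "good (\<lambda>j. c j + l * (d j - c j))" "l \<noteq> 0"
      by auto
    let ?t = "\<lambda>j. c j + l * (d j - c j)"
    have "h m \<noteq> h k" if "m < N" "m \<ge> Suc k" for m
      using inj_onD[OF bij_betw_imp_inj_on[OF h], of m k] k that by auto
    then have "?t \<in> L (Suc k)" by (auto simp: L_def d_def)
    then have "pic ?t \<in> Z (Suc k)" using WZ l by (auto simp: W_def)
    moreover have "pic ?t \<notin> zero_locus V E p" using p(2)[OF l(1)] l(2) by (simp add: d_def)
    ultimately show "Z k \<noteq> Z (Suc k)" using Zk by blast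
  qed
  show ?thesis
    unfolding krull_dim_def N_def[symmetric] using 1 2 by (intro Sup_upper) blast
qed

end

section \<open>The length of a chain ending in a chart\<close>

context finite_config
begin

text \<open>One number replaces the two degree functions, so that degrees of products and powers are
  computed as for ordinary homogeneous polynomials.\<close>

definition uniform_degree :: "nat \<Rightarrow> ('a::field, 'n::finite, 'v) picture_poly \<Rightarrow> bool" where
  "uniform_degree k p \<longleftrightarrow>
    has_multidegree V E (\<lambda>v. if v \<in> V then k else 0) (\<lambda>e. if e \<in> E then k else 0) p"

lemma uniform_degree_multihomogeneous: "uniform_degree k p \<Longrightarrow> multihomogeneous V E p"
  unfolding uniform_degree_def multihomogeneous_iff by blast

lemma uniform_degree_mult:
  assumes "uniform_degree k p" "uniform_degree l q"
  shows "uniform_degree (k + l) (p * q)"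
proof -
  have *: "(\<lambda>x. (if x \<in> X then k else 0) + (if x \<in> X then l else 0)) = (\<lambda>x. if x \<in> X then k + l else 0)"
    for X :: "'x set"
    by auto
  show ?thesis
    using has_multidegree_mult[OF assms[unfolded uniform_degree_def]] unfolding * uniform_degree_def .
qed

lemma uniform_degree_const: "uniform_degree 0 (poly_const c)"
  using has_multidegree_const[of V E c] by (simp add: uniform_degree_def if_distrib)

lemma uniform_degree_one: "uniform_degree 0 1"
  using uniform_degree_const[of 1] by (simp add: poly_const_def)

lemma uniform_degree_power: "uniform_degree k p \<Longrightarrow> uniform_degree (n * k) (p ^ n)"
proof (induction n)
  case 0
  then show ?case using uniform_degree_one by simp
next
  case (Suc n)
  then show ?case using uniform_degree_mult[of k p "n * k" "p ^ n"] by simp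
qed

lemma uniform_degree_prod_lessThan:
  fixes m :: nat
  shows "(\<And>i. i < m \<Longrightarrow> uniform_degree (k i) (p i)) \<Longrightarrow> uniform_degree (\<Sum>i<m. k i) (\<Prod>i<m. p i)"
proof (induction m)
  case 0
  then show ?case using uniform_degree_one by simp
next
  case (Suc m)
  then have "uniform_degree (\<Sum>i<m. k i) (\<Prod>i<m. p i)" "uniform_degree (k m) (p m)" by auto
  from uniform_degree_mult[OF this] show ?case by (simp add: mult.commute)
qed

lemma uniform_degree_sum:
  "(\<And>x. x \<in> A \<Longrightarrow> uniform_degree k (p x)) \<Longrightarrow> uniform_degree k (sum p A)"
  unfolding uniform_degree_def by (intro has_multidegree_sum) auto

section \<open>Bringing polynomials to a common degree\<close>

text \<open>At each vertex and each edge some coordinate of \<open>P\<close> is nonzero; the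
  monomial takes that coordinate to the prescribed power.\<close>

lemma nonvanishing_monomial_exists:
  assumes P: "P \<in> ambient_space V E" and a: "\<And>v. v \<notin> V \<Longrightarrow> a v = 0" and b: "\<And>e. e \<notin> E \<Longrightarrow> b e = 0"
  shows "\<exists>h :: ('a::field, 'n::finite, 'v) picture_poly. has_multidegree V E a b h \<and> P \<notin> zero_locus V E h"
proof -
  let ?c = "coords P"
  note c = coordinates_of_coords[OF P]
  have "\<exists>i. ?c (PointCoord v i) \<noteq> 0" if v: "v \<in> V" for v
  proof -
    obtain x where x: "vec.span {x} = fst P v" "\<And>i. ?c (PointCoord v i) = x $ i"
      using c v unfolding coordinates_of_def by blast
    have "vec.dim (vec.span {x}) = 1"
      using ambient_space_point[OF P v] x by (simp add: proj_points_def)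
    then have "x \<noteq> 0" by auto
    then show ?thesis using x by (auto simp: vec_eq_iff)
  qed
  then obtain i where i: "\<And>v. v \<in> V \<Longrightarrow> ?c (PointCoord v (i v)) \<noteq> 0" by metis
  have "\<exists>j k. ?c (LineCoord e j k) \<noteq> 0" if e: "e \<in> E" for e
  proof -
    obtain x y where x: "vec.span {x, y} = snd P e" "\<And>i j. ?c (LineCoord e i j) = minor x y i j"
      using c e unfolding coordinates_of_def minor_def by blast
    have "vec.dim (vec.span {x, y}) = 2"
      using ambient_space_line[OF P e] x by (simp add: proj_lines_def)
    then show ?thesis unfolding span_pair_dim_2_iff using x by auto
  qed
  then obtain j k where jk: "\<And>e. e \<in> E \<Longrightarrow> ?c (LineCoord e (j e) (k e)) \<noteq> 0" by metis
  define g1 where "g1 = (\<Prod>v\<in>V. poly_var (PointCoord v (i v)) ^ a v :: ('a, 'n, 'v) picture_poly)"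
  define g2 where "g2 = (\<Prod>e\<in>E. poly_var (LineCoord e (j e) (k e)) ^ b e :: ('a, 'n, 'v) picture_poly)"
  have "has_multidegree V E (\<lambda>w. \<Sum>v\<in>V. a v * (if w = v then 1 else 0)) (\<lambda>f. \<Sum>v\<in>V. a v * 0) g1"
    unfolding g1_def
    by (intro has_multidegree_prod has_multidegree_power has_multidegree_point_var finite_V)
  moreover have "(\<lambda>w. \<Sum>v\<in>V. a v * (if w = v then 1 else 0)) = a"
  proof
    fix w
    have "(\<Sum>v\<in>V. a v * (if w = v then 1 else 0)) = (\<Sum>v\<in>V. if w = v then a v else 0)"
      by (intro sum.cong) auto
    then show "(\<Sum>v\<in>V. a v * (if w = v then 1 else 0)) = a w"
      using finite_V a by simp
  qed
  ultimately have g1: "has_multidegree V E a (\<lambda>_. 0) g1" by simp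
  have "has_multidegree V E (\<lambda>f. \<Sum>e\<in>E. b e * 0) (\<lambda>f. \<Sum>e\<in>E. b e * (if f = e then 1 else 0)) g2"
    unfolding g2_def
    by (intro has_multidegree_prod has_multidegree_power has_multidegree_line_var finite_E)
  moreover have "(\<lambda>f. \<Sum>e\<in>E. b e * (if f = e then 1 else 0)) = b"
  proof
    fix f
    have "(\<Sum>e\<in>E. b e * (if f = e then 1 else 0)) = (\<Sum>e\<in>E. if f = e then b e else 0)"
      by (intro sum.cong) auto
    then show "(\<Sum>e\<in>E. b e * (if f = e then 1 else 0)) = b f"
      using finite_E b by simp
  qed
  ultimately have g2: "has_multidegree V E (\<lambda>_. 0) b g2" by simp
  have deg: "has_multidegree V E a b (g1 * g2)"
    using has_multidegree_mult[OF g1 g2] by simp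
  moreover have "poly_eval ?c (g1 * g2) \<noteq> 0"
    using i jk finite_V finite_E by (simp add: g1_def g2_def)
  then have "P \<notin> zero_locus V E (g1 * g2)"
    using zero_locus_coords[OF _ P] deg multihomogeneous_iff by blast
  ultimately show ?thesis by blast
qed

text \<open>A monomial not vanishing at \<open>P\<close> fills up the missing degrees. All large
  \<open>k\<close> are provided so that finitely many polynomials can share one.\<close>

lemma uniformize:
  assumes P: "P \<in> ambient_space V E" and f: "multihomogeneous V E f"
  shows "\<exists>k0. \<forall>k\<ge>k0. \<exists>h. multihomogeneous V E h \<and> P \<notin> zero_locus V E h \<and> uniform_degree k (f * h)"
proof -
  obtain a b where ab: "has_multidegree V E a b f" using f multihomogeneous_iff by blast
  show ?thesis
  \<comment> \<open>The sum of all degrees serves as a threshold because it dominates each of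
    them.\<close>
  proof (intro exI[of _ "(\<Sum>v\<in>V. a v) + (\<Sum>e\<in>E. b e)"] allI impI)
    fix k assume k: "(\<Sum>v\<in>V. a v) + (\<Sum>e\<in>E. b e) \<le> k"
    have a: "a v \<le> k" if "v \<in> V" for v
      using member_le_sum[OF that, of a] finite_V k by simp
    have b: "b e \<le> k" if "e \<in> E" for e
      using member_le_sum[OF that, of b] finite_E k by simp
    let ?a = "\<lambda>v. if v \<in> V then k - a v else 0" and ?b = "\<lambda>e. if e \<in> E then k - b e else 0"
    obtain h where h: "has_multidegree V E ?a ?b h" "P \<notin> zero_locus V E h"
      using nonvanishing_monomial_exists[OF P, of ?a ?b] by auto
    have "(\<lambda>v. a v + ?a v) = (\<lambda>v. if v \<in> V then k else 0)" "(\<lambda>e. b e + ?b e) = (\<lambda>e. if e \<in> E then k else 0)"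
      using a b ab by (auto simp: has_multidegree_def fun_eq_iff)
    then have "uniform_degree k (f * h)"
      using has_multidegree_mult[OF ab h(1)] by (simp add: uniform_degree_def)
    then show "\<exists>h. multihomogeneous V E h \<and> P \<notin> zero_locus V E h \<and> uniform_degree k (f * h)"
      using h multihomogeneous_iff by blast
  qed
qed

text \<open>The factor \<open>g\<close> pads all monomials to the same degree, so that a linear combination of them is again
  multihomogeneous.\<close>

definition homogenized_monomial :: "(nat \<Rightarrow> ('a::field, 'n::finite, 'v) picture_poly) \<Rightarrow>
    ('a, 'n, 'v) picture_poly \<Rightarrow> nat \<Rightarrow> nat \<Rightarrow> (nat \<Rightarrow> nat) \<Rightarrow> ('a, 'n, 'v) picture_poly" where
  "homogenized_monomial u g m S \<alpha> = (\<Prod>i<m. u i ^ \<alpha> i) * g ^ (S - (\<Sum>i<m. \<alpha> i))"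

lemma uniform_degree_homogenized_monomial:
  assumes u: "\<And>i. i < m \<Longrightarrow> uniform_degree k (u i)" and g: "uniform_degree k g" and S: "(\<Sum>i<m. \<alpha> i) \<le> S"
  shows "uniform_degree (S * k) (homogenized_monomial u g m S \<alpha>)"
proof -
  have "uniform_degree ((\<Sum>i<m. \<alpha> i * k) + (S - (\<Sum>i<m. \<alpha> i)) * k) (homogenized_monomial u g m S \<alpha>)"
    unfolding homogenized_monomial_def
    by (intro uniform_degree_mult uniform_degree_prod_lessThan uniform_degree_power u g)
  moreover have "(\<Sum>i<m. \<alpha> i * k) + (S - (\<Sum>i<m. \<alpha> i)) * k = S * k"
    using S by (simp add: sum_distrib_right[symmetric] distrib_right[symmetric])
  ultimately show ?thesis by simp
qed

text \<open>A relation on the largest member of the chain is pushed down one member at a time,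
  losing one variable at each step. Exponents in \<open>A\<close> are told apart by their first
  \<open>m\<close> entries, so different members of \<open>A\<close> are different
  monomials.\<close>

lemma chain_algebraically_independent:
  fixes u :: "nat \<Rightarrow> ('a::field, 'n::finite, 'v) picture_poly"
  assumes "\<And>i. i \<le> m \<Longrightarrow> irreducible_locus (Z i)"
    and "\<And>i. i < m \<Longrightarrow> Z i \<subseteq> zero_closure (Z (Suc i))"
    and "\<And>i. i < m \<Longrightarrow> uniform_degree k (u i)"
    and "\<And>i. i < m \<Longrightarrow> Z i \<subseteq> zero_locus V E (u i)"
    and "\<And>i. i < m \<Longrightarrow> \<not> Z (Suc i) \<subseteq> zero_locus V E (u i)"
    and g: "uniform_degree k g" "\<not> Z 0 \<subseteq> zero_locus V E g"
    and "finite A" and "\<And>\<alpha>. \<alpha> \<in> A \<Longrightarrow> (\<Sum>i<m. \<alpha> i) \<le> S"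
    and "\<And>\<alpha> \<beta>. \<alpha> \<in> A \<Longrightarrow> \<beta> \<in> A \<Longrightarrow> (\<And>i. i < m \<Longrightarrow> \<alpha> i = \<beta> i) \<Longrightarrow> \<alpha> = \<beta>"
    and "Z m \<subseteq> zero_locus V E (\<Sum>\<alpha>\<in>A. poly_const (c \<alpha>) * homogenized_monomial u g m S \<alpha>)"
  shows "\<forall>\<alpha>\<in>A. c \<alpha> = 0"
  using assms(1-5,8-)
proof (induction m arbitrary: A S)
  case 0
  show ?case
  proof
    fix \<alpha> assume \<alpha>: "\<alpha> \<in> A"
    \<comment> \<open>Without variables all exponents coincide, and the relation is a multiple of a
      power of \<open>g\<close>, which is nonzero somewhere on \<open>Z 0\<close>.\<close>
    then have A: "A = {\<alpha>}" using 0(8) by blast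
    have amb: "Z 0 \<subseteq> ambient_space V E" using 0(1)[of 0] by (simp add: irreducible_locus_def)
    obtain P where P: "P \<in> Z 0" "P \<notin> zero_locus V E g" using g by blast
    have "poly_eval (coords P) (poly_const (c \<alpha>) * homogenized_monomial u g 0 S \<alpha>) = 0"
      using 0(9) P amb coordinates_of_coords[of P] by (auto simp: A zero_locus_def)
    moreover have "poly_eval (coords P) g \<noteq> 0"
      using P amb zero_locus_coords[OF uniform_degree_multihomogeneous[OF g(1)], of P] by auto
    ultimately show "c \<alpha> = 0" by (simp add: homogenized_monomial_def)
  qed
next
  case (Suc m)
  show ?case
  proof (rule ccontr)
    assume nz: "\<not> (\<forall>\<alpha>\<in>A. c \<alpha> = 0)"
    define A' where "A' = {\<alpha> \<in> A. c \<alpha> \<noteq> 0}"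
    have A': "finite A'" "A' \<noteq> {}" using nz Suc.prems(6) by (auto simp: A'_def)
    define j where "j = Min ((\<lambda>\<alpha>. \<alpha> m) ` A')"
    have j: "j \<le> \<alpha> m" if "\<alpha> \<in> A'" for \<alpha>
      using that A' by (auto simp: j_def)
    have "j \<in> (\<lambda>\<alpha>. \<alpha> m) ` A'" unfolding j_def using A' by (intro Min_in) auto
    then obtain \<alpha>0 where \<alpha>0: "\<alpha>0 \<in> A'" "\<alpha>0 m = j" by blast
    \<comment> \<open>Divide by the largest power of \<open>u m\<close>; on \<open>Z m\<close> only the terms with \<open>\<alpha> m = j\<close> survive.\<close>
    define A'' where "A'' = {\<alpha> \<in> A'. \<alpha> m = j}"
    have S: "(\<Sum>i<m. \<alpha> i) + \<alpha> m \<le> S" if "\<alpha> \<in> A'" for \<alpha>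
      using Suc.prems(7)[of \<alpha>] that by (auto simp: A'_def)
    let ?T = "homogenized_monomial u g"
    \<comment> \<open>The homogenized monomial after division by \<open>u m ^ j\<close>. Its
      exponents sum to \<open>S - j\<close>, which becomes the padding bound for the next
      step.\<close>
    let ?Q = "\<lambda>\<alpha>. (\<Prod>i<m. u i ^ \<alpha> i) * u m ^ (\<alpha> m - j) * g ^ (S - (\<Sum>i<Suc m. \<alpha> i))"
    define R where "R = (\<Sum>\<alpha>\<in>A'. poly_const (c \<alpha>) * ?Q \<alpha>)"
    have u: "\<And>i. i \<le> m \<Longrightarrow> uniform_degree k (u i)" using Suc.prems(3) by simp
    note um = uniform_degree_multihomogeneous[OF u[OF order.refl]]
    have mh_pow: "multihomogeneous V E (u m ^ j)"
      using uniform_degree_multihomogeneous[OF uniform_degree_power[OF u[OF order.refl]]] .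
    have "uniform_degree ((S - j) * k) (poly_const (c \<alpha>) * ?Q \<alpha>)" if "\<alpha> \<in> A'" for \<alpha>
    proof -
      have "uniform_degree (0 + ((\<Sum>i<m. \<alpha> i * k) + (\<alpha> m - j) * k + (S - (\<Sum>i<Suc m. \<alpha> i)) * k)) (poly_const (c \<alpha>) * ?Q \<alpha>)"
        by (intro uniform_degree_mult uniform_degree_prod_lessThan uniform_degree_power u g uniform_degree_const) auto
      moreover have "(\<Sum>i<m. \<alpha> i) + (\<alpha> m - j) + (S - (\<Sum>i<Suc m. \<alpha> i)) = S - j"
        using S[OF that] j[OF that] by simp
      then have "0 + ((\<Sum>i<m. \<alpha> i * k) + (\<alpha> m - j) * k + (S - (\<Sum>i<Suc m. \<alpha> i)) * k) = (S - j) * k"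
        unfolding sum_distrib_right[symmetric] by (metis add_0 distrib_right)
      ultimately show ?thesis by simp
    qed
    then have "uniform_degree ((S - j) * k) R"
      unfolding R_def by (intro uniform_degree_sum)
    then have mhR: "multihomogeneous V E R" by (rule uniform_degree_multihomogeneous)
    have "(\<Sum>\<alpha>\<in>A. poly_const (c \<alpha>) * ?T (Suc m) S \<alpha>) = (\<Sum>\<alpha>\<in>A'. poly_const (c \<alpha>) * ?T (Suc m) S \<alpha>)"
      using Suc.prems(6) by (intro sum.mono_neutral_right) (auto simp: A'_def poly_const_def)
    also have "\<dots> = u m ^ j * R"
      unfolding R_def sum_distrib_left
    proof (rule sum.cong)
      fix \<alpha> assume "\<alpha> \<in> A'"
      then have "u m ^ \<alpha> m = u m ^ j * u m ^ (\<alpha> m - j)"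
        using j by (simp add: power_add[symmetric])
      then show "poly_const (c \<alpha>) * ?T (Suc m) S \<alpha> = u m ^ j * (poly_const (c \<alpha>) * ?Q \<alpha>)"
        unfolding homogenized_monomial_def prod.lessThan_Suc by (simp only: mult_ac)
    qed simp
    finally have "Z (Suc m) \<subseteq> zero_locus V E (u m ^ j * R)" using Suc.prems(9) by simp
    then have "Z (Suc m) \<subseteq> zero_locus V E (u m ^ j) \<union> zero_locus V E R"
      by (simp add: zero_locus_mult mh_pow mhR)
    moreover have "\<not> Z (Suc m) \<subseteq> zero_locus V E (u m ^ j)"
    proof
      assume sub: "Z (Suc m) \<subseteq> zero_locus V E (u m ^ j)"
      have "Z (Suc m) \<subseteq> zero_locus V E (u m)"
      proof
        fix P assume "P \<in> Z (Suc m)"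
        then have P: "P \<in> zero_locus V E (u m ^ j)" "P \<in> ambient_space V E"
          using sub zero_locus_subset by auto
        then show "P \<in> zero_locus V E (u m)"
          using zero_locus_coords[OF mh_pow P(2)] zero_locus_coords[OF um P(2)] by simp
      qed
      then show False using Suc.prems(5)[of m] by simp
    qed
    ultimately have "Z (Suc m) \<subseteq> zero_locus V E R"
      using irreducible_locusD[OF Suc.prems(1)[OF order.refl] mh_pow mhR] by blast
    then have ZR: "Z m \<subseteq> zero_locus V E R"
      using Suc.prems(2)[of m] mhR by (auto simp: zero_closure_def)
    let ?F = "\<Sum>\<alpha>\<in>A''. poly_const (c \<alpha>) * ?T m (S - j) \<alpha>"
    have "uniform_degree (0 + (S - j) * k) (poly_const (c \<alpha>) * ?T m (S - j) \<alpha>)" if "\<alpha> \<in> A''" for \<alpha>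
      using that S[of \<alpha>] u g
      by (intro uniform_degree_mult uniform_degree_const uniform_degree_homogenized_monomial) (auto simp: A''_def)
    then have mhF: "multihomogeneous V E ?F"
      by (intro uniform_degree_multihomogeneous[OF uniform_degree_sum])
    have ZF: "Z m \<subseteq> zero_locus V E ?F"
    proof
      fix P assume P: "P \<in> Z m"
      then have amb: "P \<in> ambient_space V E" using ZR zero_locus_subset by blast
      have um0: "poly_eval (coords P) (u m) = 0"
        using P Suc.prems(4)[of m] zero_locus_coords[OF um amb] by auto
      have "0 = poly_eval (coords P) R"
        using P ZR zero_locus_coords[OF mhR amb] by auto
      also have "\<dots> = (\<Sum>\<alpha>\<in>A'. poly_eval (coords P) (poly_const (c \<alpha>) * ?Q \<alpha>))"
        by (simp only: R_def poly_eval_sum)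
      also have "\<dots> = (\<Sum>\<alpha>\<in>A''. poly_eval (coords P) (poly_const (c \<alpha>) * ?Q \<alpha>))"
      proof (rule sum.mono_neutral_right)
        show "\<forall>\<alpha>\<in>A' - A''. poly_eval (coords P) (poly_const (c \<alpha>) * ?Q \<alpha>) = 0"
        proof
          fix \<alpha> assume "\<alpha> \<in> A' - A''"
          then have "\<alpha> m - j \<noteq> 0" using j[of \<alpha>] by (auto simp: A''_def)
          then show "poly_eval (coords P) (poly_const (c \<alpha>) * ?Q \<alpha>) = 0"
            using um0 by (simp add: zero_power)
        qed
      qed (use A' in \<open>auto simp: A''_def\<close>)
      also have "\<dots> = (\<Sum>\<alpha>\<in>A''. poly_eval (coords P) (poly_const (c \<alpha>) * ?T m (S - j) \<alpha>))"
      proof (rule sum.cong)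
        fix \<alpha> assume "\<alpha> \<in> A''"
        then have "\<alpha> m = j" by (simp add: A''_def)
        then have "S - (\<Sum>i<Suc m. \<alpha> i) = S - j - (\<Sum>i<m. \<alpha> i)" "\<alpha> m - j = 0" by auto
        then show "poly_eval (coords P) (poly_const (c \<alpha>) * ?Q \<alpha>) =
            poly_eval (coords P) (poly_const (c \<alpha>) * ?T m (S - j) \<alpha>)"
          unfolding homogenized_monomial_def by simp
      qed simp
      finally have "poly_eval (coords P) ?F = 0" by simp
      then show "P \<in> zero_locus V E ?F" using zero_locus_coords[OF mhF amb] by blast
    qed
    have "\<forall>\<alpha>\<in>A''. c \<alpha> = 0"
    proof (rule Suc.IH[OF _ _ _ _ _ _ _ _ ZF])
      show "finite A''" using A' by (simp add: A''_def)
      show "(\<Sum>i<m. \<alpha> i) \<le> S - j" if "\<alpha> \<in> A''" for \<alpha>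
        using that S[of \<alpha>] by (auto simp: A''_def)
      \<comment> \<open>Members of \<open>A''\<close> all have the value \<open>j\<close> at
        \<open>m\<close>, so their entries below \<open>m\<close> already distinguish them.\<close>
      show "\<alpha> = \<beta>" if "\<alpha> \<in> A''" "\<beta> \<in> A''" "\<And>i. i < m \<Longrightarrow> \<alpha> i = \<beta> i" for \<alpha> \<beta>
      proof (rule Suc.prems(8))
        show "\<alpha> i = \<beta> i" if "i < Suc m" for i
          using that \<open>\<alpha> \<in> A''\<close> \<open>\<beta> \<in> A''\<close> \<open>\<And>i. i < m \<Longrightarrow> \<alpha> i = \<beta> i\<close>
          by (cases "i = m") (auto simp: A''_def)
      qed (use that in \<open>auto simp: A''_def A'_def\<close>)
    qed (use Suc.prems(1-5) in \<open>auto\<close>)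
    then show False using \<alpha>0 by (auto simp: A''_def A'_def)
  qed
qed

end

section \<open>Counting monomials on a chart\<close>

context chart
begin

text \<open>The polynomials separating the chain are independent on its top, yet there they are
  polynomial functions of \<open>card params\<close> variables. The inclusions are required only up
  to closure, because the top is the chart itself and not its closure.\<close>

lemma chart_chain_length:
  fixes Z :: "nat \<Rightarrow> ('a::alg_closed_field, 'n, 'v) picture set"
  assumes irr: "\<And>i. i \<le> M \<Longrightarrow> irreducible_locus (Z i)"
    and cl: "\<And>i. i < M \<Longrightarrow> Z i \<subseteq> zero_closure (Z (Suc i))"
    and sep: "\<And>i. i < M \<Longrightarrow> \<exists>p. multihomogeneous V E p \<and> Z i \<subseteq> zero_locus V E p \<and> \<not> Z (Suc i) \<subseteq> zero_locus V E p"
    and top: "Z M = pic ` {t. good t}"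
  shows "M \<le> card params"
proof (rule ccontr)
  assume "\<not> M \<le> card params"
  then have M: "Suc (card params) \<le> M" by simp
  obtain P where P: "P \<in> Z 0" using irr[of 0] by (auto simp: irreducible_locus_def)
  then have amb: "P \<in> ambient_space V E" using irr[of 0] by (auto simp: irreducible_locus_def)
  \<comment> \<open>\<open>P\<close> lies in the smallest member, and an equation that held on a
    larger one would pass down through the closures to \<open>P\<close>.\<close>
  have nonvan: "\<not> Z i \<subseteq> zero_locus V E h" if "i \<le> M" "multihomogeneous V E h" "P \<notin> zero_locus V E h" for i h
    using that(1)
  proof (induction i)
    case 0
    then show ?case using P that by blast
  next
    case (Suc i)
    then show ?case using cl[of i] that(2) by (auto simp: zero_closure_def)
  qed
  obtain f where f: "\<And>i. i < M \<Longrightarrow> multihomogeneous V E (f i)" "\<And>i. i < M \<Longrightarrow> Z i \<subseteq> zero_locus V E (f i)"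
    "\<And>i. i < M \<Longrightarrow> \<not> Z (Suc i) \<subseteq> zero_locus V E (f i)"
    using sep by metis
  have "\<exists>k0. \<forall>i<M. \<forall>k\<ge>k0 i. \<exists>h. multihomogeneous V E h \<and> P \<notin> zero_locus V E h \<and> uniform_degree k (f i * h)"
    using uniformize[OF amb f(1)] by metis
  then obtain k0 where k0: "\<And>i k. i < M \<Longrightarrow> k \<ge> k0 i \<Longrightarrow>
      \<exists>h. multihomogeneous V E h \<and> P \<notin> zero_locus V E h \<and> uniform_degree k (f i * h)"
    by blast
  \<comment> \<open>A common degree that exceeds all the thresholds of
    \<open>uniformize\<close>.\<close>
  define k where "k = (\<Sum>i<M. k0 i)"
  have "k0 i \<le> k" if "i < M" for i
    unfolding k_def using that by (intro member_le_sum) auto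
  then have "\<forall>i\<in>{..<M}. \<exists>h. multihomogeneous V E h \<and> P \<notin> zero_locus V E h \<and> uniform_degree k (f i * h)"
    using k0 by simp
  from bchoice[OF this] obtain h where h: "\<And>i. i < M \<Longrightarrow> multihomogeneous V E (h i)" "\<And>i. i < M \<Longrightarrow> P \<notin> zero_locus V E (h i)"
    "\<And>i. i < M \<Longrightarrow> uniform_degree k (f i * h i)"
    by auto
  \<comment> \<open>Neither factor vanishes identically on the irreducible set
    \<open>Z (Suc i)\<close>, so the product separates \<open>Z i\<close> from it as
    \<open>f i\<close> did.\<close>
  define u where "u i = f i * h i" for i
  have u: "uniform_degree k (u i)" "Z i \<subseteq> zero_locus V E (u i)" "\<not> Z (Suc i) \<subseteq> zero_locus V E (u i)" if i: "i < M" for i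
  proof -
    have zu: "zero_locus V E (u i) = zero_locus V E (f i) \<union> zero_locus V E (h i)"
      unfolding u_def by (intro zero_locus_mult f h i)
    show "uniform_degree k (u i)" "Z i \<subseteq> zero_locus V E (u i)"
      using h(3)[OF i] f(2)[OF i] zu by (auto simp: u_def)
    have "\<not> Z (Suc i) \<subseteq> zero_locus V E (h i)"
      using nonvan[OF _ h(1,2)[OF i]] i by simp
    then show "\<not> Z (Suc i) \<subseteq> zero_locus V E (u i)"
      unfolding zu using irreducible_locusD[OF irr f(1)[OF i] h(1)[OF i], of "Suc i"] f(3)[OF i] i by auto
  qed
  obtain g :: "('a, 'n, 'v) picture_poly" where g: "uniform_degree k g" "P \<notin> zero_locus V E g"
    using nonvanishing_monomial_exists[OF amb, of "\<lambda>v. if v \<in> V then k else 0" "\<lambda>e. if e \<in> E then k else 0"]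
    unfolding uniform_degree_def by auto
  have "\<forall>i. \<exists>K. (\<lambda>t. poly_eval (crd t) (u i)) \<in> poly_funs params K"
    using eval_crd_poly_fun by blast
  from choice[OF this] obtain K1 where K1: "\<And>i. (\<lambda>t. poly_eval (crd t) (u i)) \<in> poly_funs params (K1 i)" by blast
  obtain K2 where K2: "(\<lambda>t. poly_eval (crd t) g) \<in> poly_funs params K2"
    using eval_crd_poly_fun by blast
  \<comment> \<open>\<open>K\<close> bounds degrees in the chart parameters, in contrast to
    \<open>k\<close>, the degree in the coordinates of each vertex and edge.\<close>
  define K where "K = (\<Sum>i<M. K1 i) + K2"
  have "K1 i \<le> K" if "i < M" for i
    unfolding K_def using that member_le_sum[of i "{..<M}" K1] by auto
  then have Ku: "(\<lambda>t. poly_eval (crd t) (u i)) \<in> poly_funs params K" if "i < M" for i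
    using poly_funs_mono[OF K1] that by blast
  have Kg: "(\<lambda>t. poly_eval (crd t) g) \<in> poly_funs params K"
    using poly_funs_mono[OF K2] by (simp add: K_def)
  define N where "N = card params"
  \<comment> \<open>Large enough for the \<open>(D + 1) ^ M\<close> monomials in \<open>u\<close> to outnumber the monomials in the parameters.\<close>
  define D where "D = (M * K + 1) ^ N"
  define S where "S = D * M"
  define A where "A = {..<M} \<rightarrow>\<^sub>E {..D}"
  have finA: "finite A" unfolding A_def by (simp add: finite_PiE)
  have sumS: "(\<Sum>i<M. \<alpha> i) \<le> S" if "\<alpha> \<in> A" for \<alpha>
  proof -
    have "(\<Sum>i<M. \<alpha> i) \<le> (\<Sum>i<M. D)"
      using that by (intro sum_mono) (auto simp: A_def PiE_def Pi_def)
    then show ?thesis by (simp add: S_def mult.commute)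
  qed
  let ?T = "homogenized_monomial u g M S"
  have T: "(\<lambda>t. poly_eval (crd t) (?T \<alpha>)) \<in> poly_funs params (S * K)" if \<alpha>: "\<alpha> \<in> A" for \<alpha>
  proof -
    have "(\<lambda>t. poly_eval (crd t) (?T \<alpha>)) \<in> poly_funs params ((\<Sum>i<M. \<alpha> i * K) + (S - (\<Sum>i<M. \<alpha> i)) * K)"
      unfolding homogenized_monomial_def poly_eval_mult poly_eval_prod poly_eval_power
      by (intro poly_funs_mult poly_funs_prod poly_funs_power Ku Kg) auto
    moreover have "(\<Sum>i<M. \<alpha> i * K) + (S - (\<Sum>i<M. \<alpha> i)) * K = S * K"
      using sumS[OF \<alpha>] by (simp add: sum_distrib_right[symmetric] distrib_right[symmetric])
    ultimately show ?thesis by simp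
  qed
  \<comment> \<open>Here \<open>S * K + 1 = D * (M * K) + 1\<close>, and the \<open>N\<close>-th
    power of the factor \<open>M * K + 1\<close> is exactly \<open>D\<close>. One more factor
    \<open>D + 1\<close>, available since \<open>M > N\<close>, gives the strict inequality.\<close>
  have "(S * K + 1) ^ N \<le> ((D + 1) * (M * K + 1)) ^ N"
    by (intro power_mono) (auto simp: S_def algebra_simps)
  also have "\<dots> = (D + 1) ^ N * D"
    by (simp only: power_mult_distrib D_def[symmetric])
  also have "\<dots> < (D + 1) ^ Suc N"
    by simp
  also have "\<dots> \<le> (D + 1) ^ M"
    using M by (intro power_increasing) (auto simp: N_def)
  also have "\<dots> = card A"
    by (simp add: A_def card_PiE)
  finally have "(S * K + 1) ^ card params < card A"
    by (simp add: N_def)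
  then have "\<exists>c. (\<exists>\<alpha>\<in>A. c \<alpha> \<noteq> 0) \<and> (\<forall>t. (\<Sum>\<alpha>\<in>A. c \<alpha> * poly_eval (crd t) (?T \<alpha>)) = 0)"
    using T by (intro poly_funs_dependent[OF finite_params finA])
  then obtain c where c: "\<exists>\<alpha>\<in>A. c \<alpha> \<noteq> 0" "\<And>t. (\<Sum>\<alpha>\<in>A. c \<alpha> * poly_eval (crd t) (?T \<alpha>)) = 0"
    by (elim exE conjE) simp
  let ?F = "\<Sum>\<alpha>\<in>A. poly_const (c \<alpha>) * ?T \<alpha>"
  have "uniform_degree (0 + S * k) (poly_const (c \<alpha>) * ?T \<alpha>)" if "\<alpha> \<in> A" for \<alpha>
    using u g sumS[OF that] by (intro uniform_degree_mult uniform_degree_const uniform_degree_homogenized_monomial)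
  then have mhF: "multihomogeneous V E ?F"
    by (intro uniform_degree_multihomogeneous[OF uniform_degree_sum])
  have ZF: "Z M \<subseteq> zero_locus V E ?F"
    unfolding top using c(2) by (auto simp: pic_zero_locus_iff[OF mhF])
  have "\<forall>\<alpha>\<in>A. c \<alpha> = 0"
  proof (rule chain_algebraically_independent[OF irr cl u g(1) _ finA sumS _ ZF])
    show "\<not> Z 0 \<subseteq> zero_locus V E g" using P g by blast
    show "\<alpha> = \<beta>" if "\<alpha> \<in> A" "\<beta> \<in> A" "\<And>i. i < M \<Longrightarrow> \<alpha> i = \<beta> i" for \<alpha> \<beta>
      using that unfolding A_def by (intro PiE_ext) auto
  qed auto
  then show False using c by blast
qed

text \<open>A name usable outside the locale, where the charts of a cellule form a family indexed by
  \<open>i0\<close> and \<open>i1\<close>.\<close>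

definition chart_image :: "('a::field, 'n, 'v) picture set" where
  "chart_image = pic ` {t. good t}"

end

section \<open>The indiscrete cellule of a heavy graph\<close>

text \<open>Lengths are integers: if all of them were below \<open>N\<close>, the supremum would be
  at most \<open>N - 1\<close>.\<close>

lemma krull_dim_ge_chain:
  assumes "ereal (real N) \<le> krull_dim T"
  shows "\<exists>n\<ge>N. \<exists>Z. (\<forall>i\<le>n. closedin T (Z i) \<and> irreducible_in T (Z i)) \<and> (\<forall>i<n. Z i \<subset> Z (Suc i))"
proof (rule ccontr)
  assume no: "\<not> ?thesis"
  \<comment> \<open>The subtraction is one of real numbers, so for \<open>N = 0\<close> the bound is
    -1 and the argument still applies.\<close>
  have "krull_dim T \<le> ereal (real N - 1)"
    unfolding krull_dim_def
  proof (rule Sup_least)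
    fix x assume "x \<in> {ereal (real n) | n. \<exists>Z. (\<forall>i\<le>n. closedin T (Z i) \<and> irreducible_in T (Z i)) \<and> (\<forall>i<n. Z i \<subset> Z (Suc i))}"
    then obtain n where n: "x = ereal (real n)"
      "\<exists>Z. (\<forall>i\<le>n. closedin T (Z i) \<and> irreducible_in T (Z i)) \<and> (\<forall>i<n. Z i \<subset> Z (Suc i))" by blast
    then have "n < N" using no not_le by blast
    then show "x \<le> ereal (real N - 1)" using n(1) by simp
  qed
  then have "ereal (real N) \<le> ereal (real N - 1)" using assms by (rule order_trans[rotated])
  then show False by simp
qed

lemma ex_other_index:
  assumes "CARD('n::finite) \<ge> 2"
  shows "\<exists>j. j \<noteq> (i :: 'n)"
proof (rule ccontr)
  assume "\<not> ?thesis"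
  then have "(UNIV :: 'n set) \<subseteq> {i}" by auto
  then have "CARD('n) \<le> card {i}" by (rule card_mono[rotated]) simp
  then show False using assms by simp
qed

lemma ex_inj_into_infinite:
  assumes "finite A" "infinite S"
  shows "\<exists>f. inj_on f A \<and> f ` A \<subseteq> S"
proof -
  obtain T where T: "finite T" "card T = card A" "T \<subseteq> S"
    using infinite_arbitrarily_large[OF assms(2)] by blast
  then obtain f where "bij_betw f A T"
    using finite_same_card_bij[OF assms(1) T(1)] by auto
  then show ?thesis using T by (auto simp: bij_betw_def)
qed

text \<open>Take a vector of \<open>U\<close> outside the span of \<open>x\<close>, subtract the
  multiple of \<open>x\<close> that clears the coordinate \<open>k\<close>, and rescale.\<close>

lemma ex_normalized_direction:
  fixes U :: "('a::field ^ 'n) set"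
  assumes U: "U \<in> proj_lines" and x: "x \<in> U" "x $ k = 1"
  shows "\<exists>i. i \<noteq> k \<and> (\<exists>y\<in>U. y $ k = 0 \<and> y $ i = 1)"
proof -
  have sub: "vec.subspace U" and dim: "vec.dim U = 2" using U by (auto simp: proj_lines_def)
  have "\<not> U \<subseteq> vec.span {x}"
  proof
    assume "U \<subseteq> vec.span {x}"
    then have "vec.dim U \<le> vec.dim {x}" by (rule vec.dim_mono)
    then show False using dim by (simp split: if_splits)
  qed
  then obtain z where z: "z \<in> U" "z \<notin> vec.span {x}" by blast
  define y where "y = z - (z $ k) *s x"
  have yU: "y \<in> U" unfolding y_def using sub z x by (intro vec.subspace_diff vec.subspace_scale)
  have "y \<noteq> 0"
  proof
    assume "y = 0"
    then have "z = (z $ k) *s x" by (simp add: y_def)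
    then show False using z(2) unfolding vec.span_singleton by blast
  qed
  then obtain i where i: "y $ i \<noteq> 0" by (auto simp: vec_eq_iff)
  have yk: "y $ k = 0" by (simp add: y_def x)
  have "inverse (y $ i) *s y \<in> U" using sub yU by (intro vec.subspace_scale)
  moreover have "(inverse (y $ i) *s y) $ k = 0" "(inverse (y $ i) *s y) $ i = 1"
    using yk i by auto
  moreover have "i \<noteq> k" using i yk by blast
  ultimately show ?thesis by blast
qed

lemma ex_normalized_point:
  assumes "U \<in> proj_points"
  shows "\<exists>x i. U = vec.span {x} \<and> x $ i = 1"
proof -
  obtain x where x: "x \<noteq> 0" "U = vec.span {x}" using assms by (rule proj_pointE)
  then obtain i where i: "x $ i \<noteq> 0" by (auto simp: vec_eq_iff)
  then have "U = vec.span {inverse (x $ i) *s x}" "(inverse (x $ i) *s x) $ i = 1"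
    using x span_scale_singleton[of "inverse (x $ i)" x] by auto
  then show ?thesis by blast
qed

lemma ex_proj_line_through:
  fixes U W :: "('a::field ^ 'n::finite) set"
  assumes n: "CARD('n) \<ge> 2" and U: "U \<in> proj_points" and W: "W \<in> proj_points"
  shows "\<exists>L\<in>proj_lines. U \<subseteq> L \<and> W \<subseteq> L"
proof -
  obtain x where x: "x \<noteq> 0" "U = vec.span {x}" using U by (rule proj_pointE)
  obtain y where y: "y \<noteq> 0" "W = vec.span {y}" using W by (rule proj_pointE)
  show ?thesis
  proof (cases "U = W")
    case True
    obtain j where j: "x $ j \<noteq> 0" using x by (auto simp: vec_eq_iff)
    obtain i where i: "i \<noteq> j" using ex_other_index[OF n] by blast
    have "minor x (axis i 1) j i \<noteq> 0" using i j by (simp add: minor_def axis_def)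
    then have "vec.span {x, axis i 1} \<in> proj_lines" by (rule span_pair_proj_line)
    moreover have "U \<subseteq> vec.span {x, axis i 1}" unfolding x(2) by (rule vec.span_mono) auto
    ultimately show ?thesis using True by blast
  next
    case False
    then obtain i j where "minor x y i j \<noteq> 0"
      using span_singleton_eq_iff_minors[OF x(1) y(1)] x(2) y(2) by blast
    then have "vec.span {x, y} \<in> proj_lines" by (rule span_pair_proj_line)
    moreover have "U \<subseteq> vec.span {x, y}" "W \<subseteq> vec.span {x, y}"
      unfolding x(2) y(2) by (rule vec.span_mono, simp)+
    ultimately show ?thesis by blast
  qed
qed

text \<open>Vectors with entry 1 at \<open>i\<close> and \<open>a\<close> elsewhere span different
  points for different \<open>a\<close>. This supplies points for the blocks other than
  \<open>B\<close>.\<close>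

lemma infinite_proj_points:
  assumes n: "CARD('n::finite) \<ge> 2"
  shows "infinite (proj_points :: ('a::alg_closed_field ^ 'n) set set)"
proof -
  obtain i j :: 'n where ij: "i \<noteq> j"
    using ex_other_index[OF n] by metis
  define x :: "'a \<Rightarrow> 'a ^ 'n" where "x a = (\<chi> k. if k = i then 1 else a)" for a
  have nz: "x a \<noteq> 0" for a by (auto simp: x_def vec_eq_iff)
  have "inj (\<lambda>a. vec.span {x a})"
  proof (rule injI)
    fix a b assume "vec.span {x a} = vec.span {x b}"
    then have "minor (x a) (x b) i j = 0"
      using span_singleton_eq_iff_minors[OF nz nz] by blast
    then show "a = b" using ij by (simp add: minor_def x_def)
  qed
  then have "infinite (range (\<lambda>a. vec.span {x a}))"
    using infinite_UNIV_alg_closed_field finite_imageD by blast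
  moreover have "range (\<lambda>a. vec.span {x a}) \<subseteq> proj_points"
    using nz span_singleton_proj_point by blast
  ultimately show ?thesis using finite_subset by blast
qed

lemma simple_graph_finite_config:
  assumes "simple_graph V E"
  shows "finite_config V E"
proof
  show "finite V" using assms by (simp add: simple_graph_def)
  then show "finite E" using assms by (intro finite_subset[of E "Pow V"]) (auto simp: simple_graph_def)
qed

section \<open>Separating the cellules and covering one by charts\<close>

context finite_config
begin

text \<open>The polynomials are the minors of the two points. They separate the end of the chain in
  the indiscrete cellule from the chart added on top.\<close>

lemma points_coincide_locus:
  assumes vw: "v \<in> V" "w \<in> V"
  shows "\<exists>q :: 'n \<Rightarrow> 'n \<Rightarrow> ('a::field, 'n::finite, 'v) picture_poly. (\<forall>i j. multihomogeneous V E (q i j)) \<and>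
    (\<forall>P\<in>ambient_space V E. fst P v = fst P w \<longleftrightarrow> (\<forall>i j. P \<in> zero_locus V E (q i j)))"
proof -
  let ?m = "\<lambda>i j. poly_var (PointCoord v i) * poly_var (PointCoord w j) :: ('a, 'n, 'v) picture_poly"
  define q where "q i j = ?m i j + poly_const (-1) * ?m j i" for i j
  let ?a = "\<lambda>u. (if u = v then 1 else 0) + (if u = w then 1 else 0) :: nat"
  have m: "has_multidegree V E ?a (\<lambda>_. 0) (?m i j)" for i j
    using has_multidegree_mult[OF has_multidegree_point_var[OF vw(1)] has_multidegree_point_var[OF vw(2)]] by simp
  have "has_multidegree V E ?a (\<lambda>_. 0) (q i j)" for i j
    unfolding q_def using has_multidegree_mult[OF has_multidegree_const m]
    by (intro has_multidegree_add m) simp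
  then have mh: "multihomogeneous V E (q i j)" for i j
    using multihomogeneous_iff by blast
  have "fst P v = fst P w \<longleftrightarrow> (\<forall>i j. P \<in> zero_locus V E (q i j))" if P: "P \<in> ambient_space V E" for P
  proof -
    note c = coordinates_of_coords[OF P]
    obtain x where x: "vec.span {x} = fst P v" "\<And>i. coords P (PointCoord v i) = x $ i"
      using c vw unfolding coordinates_of_def by blast
    obtain y where y: "vec.span {y} = fst P w" "\<And>i. coords P (PointCoord w i) = y $ i"
      using c vw unfolding coordinates_of_def by blast
    have "vec.dim (vec.span {x}) = 1" "vec.dim (vec.span {y}) = 1"
      using ambient_space_point[OF P vw(1)] ambient_space_point[OF P vw(2)] x y by (auto simp: proj_points_def)
    then have nz: "x \<noteq> 0" "y \<noteq> 0" by auto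
    have "P \<in> zero_locus V E (q i j) \<longleftrightarrow> minor x y i j = 0" for i j
      unfolding zero_locus_coords[OF mh P] by (simp add: q_def x y minor_def mult.commute)
    then show ?thesis
      using span_singleton_eq_iff_minors[OF nz] x y by simp
  qed
  then show ?thesis using mh by blast
qed

text \<open>Every block has a vector with some entry 1, and every line inside a block a normalized
  direction. The index maps are extensional, so only finitely many charts are involved.\<close>

lemma ex_chart_containing:
  fixes P :: "('a::field, 'n::finite, 'v) picture" and r :: "'v \<Rightarrow> 'r"
  assumes n: "CARD('n) \<ge> 2"
    and edge: "\<And>e. e \<in> E \<Longrightarrow> e = {a1 e, a2 e}" "\<And>e. e \<in> E \<Longrightarrow> a1 e \<in> V" "\<And>e. e \<in> E \<Longrightarrow> a2 e \<in> V"
    and P: "P \<in> cellule_of r"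
  shows "\<exists>i0\<in>r ` V \<rightarrow>\<^sub>E UNIV. \<exists>i1\<in>E \<rightarrow>\<^sub>E UNIV. chart V E r i0 i1 a1 a2 \<and> P \<in> chart.chart_image V E r i0 i1 a1 a2"
proof -
  have amb: "P \<in> ambient_space V E" using P cellule_of_subset_ambient by blast
  have "\<forall>\<rho>\<in>r ` V. \<exists>z. fst z $ snd z = 1 \<and> (\<forall>v\<in>V. r v = \<rho> \<longrightarrow> fst P v = vec.span {fst z})"
  proof
    fix \<rho> assume "\<rho> \<in> r ` V"
    then obtain v where v: "v \<in> V" "\<rho> = r v" by blast
    obtain x i where "fst P v = vec.span {x}" "x $ i = 1"
      using ex_normalized_point[OF ambient_space_point[OF amb v(1)]] by blast
    moreover have "fst P w = fst P v" if "w \<in> V" "r w = \<rho>" for w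
      using P v that by (auto simp: cellule_of_def)
    ultimately show "\<exists>z. fst z $ snd z = 1 \<and> (\<forall>v\<in>V. r v = \<rho> \<longrightarrow> fst P v = vec.span {fst z})"
      by (intro exI[of _ "(x, i)"]) auto
  qed
  from bchoice[OF this] obtain z where
    z: "\<And>\<rho>. \<rho> \<in> r ` V \<Longrightarrow> fst (z \<rho>) $ snd (z \<rho>) = 1"
       "\<And>v. v \<in> V \<Longrightarrow> fst P v = vec.span {fst (z (r v))}" by auto
  define i0 where "i0 = restrict (\<lambda>\<rho>. snd (z \<rho>)) (r ` V)"
  \<comment> \<open>An index \<open>i1\<close> is chosen for every edge, as the locale asks, while
    the conditions on the direction concern only edges inside a block.\<close>
  have "\<forall>e\<in>E. \<exists>y. snd y \<noteq> i0 (r (a1 e)) \<and>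
      (r (a1 e) = r (a2 e) \<longrightarrow> fst y \<in> snd P e \<and> fst y $ i0 (r (a1 e)) = 0 \<and> fst y $ snd y = 1)"
  proof
    fix e assume e: "e \<in> E"
    have "a1 e \<in> e" using edge(1)[OF e] by blast
    then have "fst P (a1 e) \<subseteq> snd P e" using P e by (auto simp: cellule_of_def picture_space_def)
    then have "fst (z (r (a1 e))) \<in> snd P e"
      using z(2)[OF edge(2)[OF e]] vec.span_base[of "fst (z (r (a1 e)))" "{fst (z (r (a1 e)))}"] by auto
    moreover have "fst (z (r (a1 e))) $ i0 (r (a1 e)) = 1"
      using z(1) edge(2)[OF e] by (simp add: i0_def)
    ultimately obtain i y where "i \<noteq> i0 (r (a1 e))" "y \<in> snd P e" "y $ i0 (r (a1 e)) = 0" "y $ i = 1"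
      using ex_normalized_direction[OF ambient_space_line[OF amb e]] by blast
    then show "\<exists>y. snd y \<noteq> i0 (r (a1 e)) \<and>
      (r (a1 e) = r (a2 e) \<longrightarrow> fst y \<in> snd P e \<and> fst y $ i0 (r (a1 e)) = 0 \<and> fst y $ snd y = 1)"
      by (intro exI[of _ "(y, i)"]) auto
  qed
  from bchoice[OF this] obtain y where
    y: "\<And>e. e \<in> E \<Longrightarrow> snd (y e) \<noteq> i0 (r (a1 e))"
       "\<And>e. e \<in> E \<Longrightarrow> r (a1 e) = r (a2 e) \<Longrightarrow>
          fst (y e) \<in> snd P e \<and> fst (y e) $ i0 (r (a1 e)) = 0 \<and> fst (y e) $ snd (y e) = 1" by blast
  define i1 where "i1 = restrict (\<lambda>e. snd (y e)) E"
  have i1: "i1 e \<noteq> i0 (r (a1 e))" if "e \<in> E" for e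
    using y(1)[OF that] that by (simp add: i1_def)
  interpret C: chart V E r i0 i1 a1 a2
    using edge i1 by unfold_locales auto
  have "\<exists>t. C.good t \<and> C.pic t = P"
  proof (rule C.pic_surj[OF P])
    show "fst (z \<rho>) $ i0 \<rho> = 1" if "\<rho> \<in> r ` V" for \<rho>
      using z(1)[OF that] that by (simp add: i0_def)
    show "fst P v = vec.span {fst (z (r v))}" if "v \<in> V" for v
      using z(2)[OF that] .
    show "fst (y e) \<in> snd P e \<and> fst (y e) $ i0 (r (a1 e)) = 0 \<and> fst (y e) $ i1 e = 1" if "e \<in> C.inner" for e
      using that y(2)[of e] by (auto simp: C.inner_def i1_def)
  qed
  then have "P \<in> C.chart_image" unfolding C.chart_image_def by blast
  moreover have "i0 \<in> r ` V \<rightarrow>\<^sub>E UNIV" "i1 \<in> E \<rightarrow>\<^sub>E UNIV" by (auto simp: i0_def i1_def)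
  ultimately show ?thesis using C.chart_axioms by blast
qed

lemma indiscrete_cellule_not_in_closure:
  fixes r :: "'v \<Rightarrow> 'r"
  assumes n: "CARD('n::finite) \<ge> 2" and graph: "simple_graph V E"
    and vw: "v \<in> V" "w \<in> V" "r v \<noteq> r w"
    and dim: "krull_dim (sub_topology (cellule_of r :: ('a::alg_closed_field, 'n, 'v) picture set)) \<le>
      krull_dim (sub_topology (cellule_of (\<lambda>_. ()) :: ('a, 'n, 'v) picture set))"
  shows "\<not> (cellule_of (\<lambda>_. ()) :: ('a, 'n, 'v) picture set) \<subseteq> zero_closure (cellule_of r)"
proof
  let ?X = "cellule_of (\<lambda>_. ()) :: ('a, 'n, 'v) picture set"
  assume sub: "?X \<subseteq> zero_closure (cellule_of r)"
  have "\<forall>e\<in>E. \<exists>a. e = {fst a, snd a} \<and> fst a \<in> V \<and> snd a \<in> V"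
  proof
    fix e assume "e \<in> E"
    then have "card e = 2" "e \<subseteq> V" using graph by (auto simp: simple_graph_def)
    then obtain x y where "e = {x, y}" "x \<in> V" "y \<in> V" by (auto simp: card_2_iff)
    then show "\<exists>a. e = {fst a, snd a} \<and> fst a \<in> V \<and> snd a \<in> V" by (intro exI[of _ "(x, y)"]) auto
  qed
  from bchoice[OF this] obtain a where
    a: "\<And>e. e \<in> E \<Longrightarrow> e = {fst (a e), snd (a e)} \<and> fst (a e) \<in> V \<and> snd (a e) \<in> V" by blast
  define a1 a2 where "a1 e = fst (a e)" and "a2 e = snd (a e)" for e
  have edge: "e \<in> E \<Longrightarrow> e = {a1 e, a2 e}" "e \<in> E \<Longrightarrow> a1 e \<in> V" "e \<in> E \<Longrightarrow> a2 e \<in> V" for e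
    unfolding a1_def a2_def using a by blast+
  obtain i j :: 'n where ij: "i \<noteq> j"
    using ex_other_index[OF n] by metis
  \<comment> \<open>Constant indices give a chart for any labelling; it serves to bound the
    dimension of the cellule of \<open>r\<close> from below.\<close>
  interpret C0: chart V E r "\<lambda>_. i" "\<lambda>_. j" a1 a2
    using edge ij by unfold_locales auto
  define N where "N = card C0.params"
  obtain g :: "'r \<Rightarrow> 'a" where g: "inj_on g (r ` V)"
    using ex_inj_into_infinite[OF _ infinite_UNIV_alg_closed_field, of "r ` V"] finite_V by blast
  \<comment> \<open>The vector of a label has entry 1 at \<open>i\<close> and a value injective in
    the label elsewhere, so different labels get different points.\<close>
  define c0 where "c0 = (\<lambda>k :: 'r \<times> 'n + 'v set \<times> 'n. case k of Inl (\<rho>, _) \<Rightarrow> g \<rho> | Inr _ \<Rightarrow> 0)"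
  have "C0.good c0"
    unfolding C0.good_def
  proof (intro ballI impI)
    fix \<rho> \<rho>' assume \<rho>: "\<rho> \<in> r ` V" "\<rho>' \<in> r ` V" "\<rho> \<noteq> \<rho>'"
    then have "g \<rho> \<noteq> g \<rho>'" using g by (auto dest: inj_onD)
    then have "minor (C0.pt c0 \<rho>) (C0.pt c0 \<rho>') i j \<noteq> 0"
      using ij by (simp add: minor_def C0.pt_def c0_def)
    then show "\<exists>i j. minor (C0.pt c0 \<rho>) (C0.pt c0 \<rho>') i j \<noteq> 0" by blast
  qed
  from C0.krull_dim_cellule_ge[OF this] dim
  have "ereal (real N) \<le> krull_dim (sub_topology ?X)"
    unfolding N_def by (rule order_trans)
  from krull_dim_ge_chain[OF this] obtain n Z where nN: "n \<ge> N"
    and Z0: "\<forall>i\<le>n. closedin (sub_topology ?X) (Z i) \<and> irreducible_in (sub_topology ?X) (Z i)"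
      "\<forall>i<n. Z i \<subset> Z (Suc i)"
    by (elim exE conjE) (rule that)
  have Z: "i \<le> n \<Longrightarrow> closedin (sub_topology ?X) (Z i)" "i \<le> n \<Longrightarrow> irreducible_in (sub_topology ?X) (Z i)"
      "i < n \<Longrightarrow> Z i \<subset> Z (Suc i)" for i
    using Z0 by auto
  have irr: "irreducible_locus (Z i)" and ZX: "Z i \<subseteq> ?X" if "i \<le> n" for i
    using Z(2)[OF that] irreducible_in_sub_topology_iff[OF cellule_of_subset] by blast+
  define idx where "idx = {(i0, i1) \<in> (r ` V \<rightarrow>\<^sub>E (UNIV :: 'n set)) \<times> (E \<rightarrow>\<^sub>E UNIV). chart V E r i0 i1 a1 a2}"
  define W :: "('r \<Rightarrow> 'n) \<times> ('v set \<Rightarrow> 'n) \<Rightarrow> ('a, 'n, 'v) picture set"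
    where "W x = chart.chart_image V E r (fst x) (snd x) a1 a2" for x
  have "finite ((r ` V \<rightarrow>\<^sub>E (UNIV :: 'n set)) \<times> (E \<rightarrow>\<^sub>E (UNIV :: 'n set)))"
    using finite_V finite_E by (intro finite_cartesian_product finite_PiE) auto
  then have fin: "finite idx" by (rule rev_finite_subset) (auto simp: idx_def)
  have cover: "cellule_of r \<subseteq> (\<Union>x\<in>idx. W x)"
  proof
    fix P :: "('a, 'n, 'v) picture" assume "P \<in> cellule_of r"
    from ex_chart_containing[OF \<open>CARD('n) \<ge> 2\<close> edge this] obtain i0 i1
      where "i0 \<in> r ` V \<rightarrow>\<^sub>E UNIV" "i1 \<in> E \<rightarrow>\<^sub>E UNIV" "chart V E r i0 i1 a1 a2"
        "P \<in> chart.chart_image V E r i0 i1 a1 a2" by blast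
    then have "(i0, i1) \<in> idx" "P \<in> W (i0, i1)" by (auto simp: idx_def W_def)
    then show "P \<in> (\<Union>x\<in>idx. W x)" by blast
  qed
  \<comment> \<open>Otherwise each chart has an equation that fails on \<open>Z n\<close>. Their
    product vanishes on the cellule of \<open>r\<close>, hence on its closure and on
    \<open>Z n\<close>, against irreducibility.\<close>
  have "\<exists>x\<in>idx. Z n \<subseteq> zero_closure (W x)"
  proof (rule ccontr)
    assume "\<not> ?thesis"
    then have "\<forall>x\<in>idx. \<exists>p. multihomogeneous V E p \<and> W x \<subseteq> zero_locus V E p \<and> \<not> Z n \<subseteq> zero_locus V E p"
      unfolding zero_closure_def by blast
    from bchoice[OF this] obtain p where
      p: "\<And>x. x \<in> idx \<Longrightarrow> multihomogeneous V E (p x)" "\<And>x. x \<in> idx \<Longrightarrow> W x \<subseteq> zero_locus V E (p x)"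
        "\<And>x. x \<in> idx \<Longrightarrow> \<not> Z n \<subseteq> zero_locus V E (p x)" by blast
    have mh: "multihomogeneous V E (prod p idx)" using fin p(1) by (rule multihomogeneous_prod)
    have "zero_locus V E (prod p idx) = (\<Union>x\<in>idx. zero_locus V E (p x))"
      using fin p(1) by (rule zero_locus_prod)
    moreover have "(\<Union>x\<in>idx. W x) \<subseteq> (\<Union>x\<in>idx. zero_locus V E (p x))"
      using p(2) by (rule UN_mono[OF order.refl])
    ultimately have "cellule_of r \<subseteq> zero_locus V E (prod p idx)"
      using cover by simp
    then have "?X \<subseteq> zero_locus V E (prod p idx)"
      using sub mh by (auto simp: zero_closure_def)
    then have "Z n \<subseteq> zero_locus V E (prod p idx)" using ZX by blast
    from irreducible_locus_prod[OF irr[OF order.refl] fin p(1) this] show False using p(3) by blast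
  qed
  then obtain i0 i1 where x: "(i0, i1) \<in> idx" "Z n \<subseteq> zero_closure (W (i0, i1))" by auto
  interpret C: chart V E r i0 i1 a1 a2 using x(1) by (simp add: idx_def)
  let ?W = "C.pic ` {t. C.good t} :: ('a, 'n, 'v) picture set"
  have W: "W (i0, i1) = ?W" by (simp add: W_def C.chart_image_def)
  \<comment> \<open>The constant 1 vanishes on the empty set, so the closure of an empty chart would
    be empty.\<close>
  have ne: "?W \<noteq> {}"
  proof
    assume "?W = {}"
    then have "Z n \<subseteq> zero_locus V E 1"
      using x(2) multihomogeneous_one unfolding W zero_closure_def by blast
    then show False using irr[of n] by (simp add: zero_locus_one irreducible_locus_def)
  qed
  then obtain c1 :: "'r \<times> 'n + 'v set \<times> 'n \<Rightarrow> 'a" where c1: "C.good c1" by blast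
  have irrW: "irreducible_locus ?W"
    using C.chart_irreducible[of UNIV c1] c1 by simp
  \<comment> \<open>The given chain with the chart on top: it has \<open>n + 1\<close> steps, one
    more than the \<open>N\<close> parameters allow when \<open>n\<close> is at least
    \<open>N\<close>.\<close>
  define Y where "Y i = (if i \<le> n then Z i else ?W)" for i
  have "Suc n \<le> card C.params"
  proof (rule C.chart_chain_length[of _ Y])
    show "irreducible_locus (Y i)" if "i \<le> Suc n" for i
      using irr irrW by (simp add: Y_def)
    show "Y i \<subseteq> zero_closure (Y (Suc i))" if "i < Suc n" for i
    proof (cases "i = n")
      case True
      then show ?thesis using x(2) W by (simp add: Y_def)
    next
      case False
      then show ?thesis
        using Z(3)[of i] that subset_zero_closure[of "Z (Suc i)"] by (auto simp: Y_def)
    qed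
    show "\<exists>p. multihomogeneous V E p \<and> Y i \<subseteq> zero_locus V E p \<and> \<not> Y (Suc i) \<subseteq> zero_locus V E p" if "i < Suc n" for i
    proof (cases "i = n")
      case True
      \<comment> \<open>On the indiscrete cellule the points of \<open>v\<close> and
        \<open>w\<close> coincide; in \<open>C.pic c1\<close> they differ, so one of their minors
        does not vanish there.\<close>
      obtain q :: "'n \<Rightarrow> 'n \<Rightarrow> ('a, 'n, 'v) picture_poly" where q: "\<And>i j. multihomogeneous V E (q i j)"
        "\<And>P. P \<in> ambient_space V E \<Longrightarrow> fst P v = fst P w \<longleftrightarrow> (\<forall>i j. P \<in> zero_locus V E (q i j))"
        using points_coincide_locus[OF vw(1,2)] by blast
      have "C.pic c1 \<in> cellule_of r" using C.pic_in_cellule[OF c1] .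
      then have "fst (C.pic c1) v \<noteq> fst (C.pic c1) w" "C.pic c1 \<in> ambient_space V E"
        using vw cellule_of_subset_ambient[of r] by (auto simp: cellule_of_def)
      then obtain i' j' where "C.pic c1 \<notin> zero_locus V E (q i' j')" using q(2) by blast
      then have "\<not> ?W \<subseteq> zero_locus V E (q i' j')" using c1 by blast
      moreover have "?X \<subseteq> zero_locus V E (q i' j')"
      proof
        fix P assume P: "P \<in> ?X"
        then have eq: "fst P v = fst P w" using vw unfolding cellule_of_def by blast
        have "P \<in> ambient_space V E" using P cellule_of_subset_ambient by (rule subsetD[rotated])
        from q(2)[OF this] eq show "P \<in> zero_locus V E (q i' j')" by blast
      qed
      then have "Z n \<subseteq> zero_locus V E (q i' j')" using ZX by blast
      ultimately have "Y i \<subseteq> zero_locus V E (q i' j') \<and> \<not> Y (Suc i) \<subseteq> zero_locus V E (q i' j')"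
        using True by (simp add: Y_def)
      then show ?thesis using q(1) by blast
    next
      case False
      then have i: "i < n" using that by simp
      obtain P where P: "P \<in> Z (Suc i)" "P \<notin> Z i" using Z(3)[OF i] by blast
      have "P \<in> ?X - Z i" using P ZX[of "Suc i"] i by auto
      from closedin_separation[OF cellule_of_subset Z(1) this] i
      obtain p where "multihomogeneous V E p" "Z i \<subseteq> zero_locus V E p" "P \<notin> zero_locus V E p" by auto
      then show ?thesis using P i by (auto simp: Y_def)
    qed
    show "Y (Suc n) = ?W" by (simp add: Y_def)
  qed
  moreover have "card C.params = N"
    unfolding N_def C.card_params C0.card_params by (simp add: C.inner_def C0.inner_def)
  ultimately show False using nN by simp
qed

end

section \<open>Restriction to an induced subgraph\<close>

definition restrict_picture ::
    "'v set \<Rightarrow> 'v set set \<Rightarrow> ('a::field, 'n, 'v) picture \<Rightarrow> ('a, 'n, 'v) picture" where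
  "restrict_picture B F P = (restrict (fst P) B, restrict (snd P) F)"

lemma restrict_picture_ambient:
  assumes "P \<in> ambient_space V E" "B \<subseteq> V" "F \<subseteq> E"
  shows "restrict_picture B F P \<in> ambient_space B F"
  using assms by (auto simp: restrict_picture_def ambient_space_def)

text \<open>Coordinates of \<open>P\<close> are also coordinates of its restriction, so both sides
  evaluate \<open>p\<close> at the same values.\<close>

lemma restrict_picture_zero_locus:
  assumes V: "finite_config V E" and B: "finite_config B F" "B \<subseteq> V" "F \<subseteq> E"
    and P: "P \<in> ambient_space V E" and p: "multihomogeneous B F p"
  shows "restrict_picture B F P \<in> zero_locus B F p \<longleftrightarrow> P \<in> zero_locus V E p"
proof -
  obtain c where c: "coordinates_of V E P c" using coordinates_of_exists[OF P] by blast
  then have "coordinates_of B F (restrict_picture B F P) c"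
    using B(2,3) by (auto simp: coordinates_of_def restrict_picture_def)
  then show ?thesis
    using finite_config.zero_locus_iff[OF V multihomogeneous_superset[OF p B(2,3)] P c]
      finite_config.zero_locus_iff[OF B(1) p restrict_picture_ambient[OF P B(2,3)]] by blast
qed

lemma partition_on_block_unique:
  assumes "partition_on A P" "X \<in> P" "Y \<in> P" "x \<in> X" "x \<in> Y"
  shows "X = Y"
  using disjointD[OF partition_onD2[OF assms(1)] assms(2,3)] assms(4,5) by blast

text \<open>The other blocks of \<pi> receive pairwise distinct points different from the common
  point of \<open>Q\<close>. Lines inside \<open>B\<close> are those of \<open>Q\<close>, and every
  other edge gets some line through the points of its ends.\<close>

lemma ex_cellule_extension:
  fixes Q :: "('a::alg_closed_field, 'n::finite, 'v) picture"
  assumes n: "CARD('n) \<ge> 2" and graph: "simple_graph V E" and part: "partition_on V \<pi>" and B: "B \<in> \<pi>"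
    and Q: "Q \<in> cellule B (induced_edges E B) {B}"
  shows "\<exists>P \<in> cellule V E \<pi>. restrict_picture B (induced_edges E B) P = Q"
proof -
  let ?F = "induced_edges E B"
  have QA: "Q \<in> ambient_space B ?F" and Qinc: "\<And>e v. e \<in> ?F \<Longrightarrow> v \<in> e \<Longrightarrow> fst Q v \<subseteq> snd Q e"
    using Q by (auto simp: cellule_def picture_space_def)
  have BV: "B \<subseteq> V" "B \<noteq> {}" using part B by (auto simp: partition_on_def)
  then obtain v0 where v0: "v0 \<in> B" by blast
  have Qv: "fst Q v = fst Q v0" if "v \<in> B" for v
    using Q v0 that unfolding cellule_def by blast
  have q: "fst Q v0 \<in> proj_points" using QA v0 by (auto simp: ambient_space_def)
  have "finite (\<pi> - {B})"
    using finite_elements[OF _ part] graph by (auto simp: simple_graph_def)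
  moreover have "infinite (proj_points - {fst Q v0})"
    using infinite_proj_points[OF n, where 'a = 'a] by simp
  ultimately have "\<exists>f. inj_on f (\<pi> - {B}) \<and> f ` (\<pi> - {B}) \<subseteq> proj_points - {fst Q v0}"
    by (rule ex_inj_into_infinite)
  then obtain f where f: "inj_on f (\<pi> - {B})" "f ` (\<pi> - {B}) \<subseteq> proj_points - {fst Q v0}"
    by (elim exE conjE) (rule that)
  define g where "g = f(B := fst Q v0)"
  have g_inj: "inj_on g \<pi>" unfolding g_def using f by (auto simp: inj_on_def)
  have g_pt: "g A \<in> proj_points" if "A \<in> \<pi>" for A
    unfolding g_def using f q that by auto
  define blk where "blk v = (SOME A. A \<in> \<pi> \<and> v \<in> A)" for v
  have blk: "blk v \<in> \<pi> \<and> v \<in> blk v" if "v \<in> V" for v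
  proof -
    have "\<exists>A. A \<in> \<pi> \<and> v \<in> A" using partition_onD1[OF part] that by blast
    from someI_ex[OF this] show ?thesis unfolding blk_def .
  qed
  have blk_eq: "blk v = A" if "A \<in> \<pi>" "v \<in> A" for v A
  proof -
    have "v \<in> V" using part that by (auto simp: partition_on_def)
    from blk[OF this] show ?thesis
      using partition_on_block_unique[OF part _ that(1) _ that(2), of "blk v"] by blast
  qed
  have "\<forall>e\<in>E. \<exists>L\<in>proj_lines. \<forall>v\<in>e. g (blk v) \<subseteq> L"
  proof
    fix e assume "e \<in> E"
    then have "card e = 2" "e \<subseteq> V" using graph by (auto simp: simple_graph_def)
    then obtain x y where "e = {x, y}" "x \<in> V" "y \<in> V" by (auto simp: card_2_iff)
    moreover from this obtain L where "L \<in> proj_lines" "g (blk x) \<subseteq> L" "g (blk y) \<subseteq> L"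
      using ex_proj_line_through[OF n g_pt g_pt] blk by blast
    ultimately show "\<exists>L\<in>proj_lines. \<forall>v\<in>e. g (blk v) \<subseteq> L" by auto
  qed
  then obtain L where L: "\<And>e. e \<in> E \<Longrightarrow> L e \<in> proj_lines" "\<And>e v. e \<in> E \<Longrightarrow> v \<in> e \<Longrightarrow> g (blk v) \<subseteq> L e"
    by metis
  define P where "P = (restrict (\<lambda>v. g (blk v)) V, restrict (\<lambda>e. if e \<in> ?F then snd Q e else L e) E)"
  have FE: "?F \<subseteq> E" and FB: "\<And>e. e \<in> ?F \<Longrightarrow> e \<subseteq> B" by (auto simp: induced_edges_def)
  have gB: "g (blk v) = fst Q v" if "v \<in> B" for v
    using blk_eq[OF B that] Qv[OF that] by (simp add: g_def)
  have "P \<in> ambient_space V E"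
    unfolding P_def ambient_space_def using g_pt blk L(1) ambient_space_line[OF QA] by auto
  moreover have "fst P v \<subseteq> snd P e" if e: "e \<in> E" and v: "v \<in> e" for e v
  proof -
    have "v \<in> V" using e v graph by (auto simp: simple_graph_def)
    show ?thesis
    proof (cases "e \<in> ?F")
      case True
      then have "v \<in> B" using FB v by blast
      then show ?thesis using \<open>v \<in> V\<close> e True gB Qinc[OF True v] by (simp add: P_def)
    next
      case False
      then show ?thesis using \<open>v \<in> V\<close> e L(2)[OF e v] by (simp add: P_def)
    qed
  qed
  moreover have "fst P v = fst P w \<longleftrightarrow> (\<exists>A\<in>\<pi>. v \<in> A \<and> w \<in> A)" if vw: "v \<in> V" "w \<in> V" for v w
  proof -
    have "fst P v = fst P w \<longleftrightarrow> blk v = blk w"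
      using vw g_inj blk by (auto simp: P_def dest: inj_onD)
    then show ?thesis using blk[OF vw(1)] blk[OF vw(2)] blk_eq by metis
  qed
  ultimately have "P \<in> cellule V E \<pi>" by (simp add: cellule_def picture_space_def)
  moreover have "restrict_picture B ?F P = Q"
  proof (rule prod_eqI)
    show "fst (restrict_picture B ?F P) = fst Q"
      using gB BV QA
      by (auto simp: restrict_picture_def P_def ambient_space_def fun_eq_iff PiE_def extensional_def)
    show "snd (restrict_picture B ?F P) = snd Q"
      using FE QA
      by (auto simp: restrict_picture_def P_def ambient_space_def fun_eq_iff PiE_def extensional_def)
  qed
  ultimately show ?thesis by blast
qed

theorem proposition2p8:
  fixes V :: "'v set" and E :: "'v set set" and B :: "'v set" and \<sigma> \<pi> :: "'v set set" and d :: nat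
  assumes "d \<ge> 2" and "CARD('n::finite) = d + 1"
    and "simple_graph V E"
    and "refines V \<sigma> \<pi>"
    and "B \<in> \<pi> - \<sigma>"
    and "d_heavy TYPE('a::alg_closed_field ^ 'n) B (induced_edges E B)"
  shows "\<not> (cellule V E \<pi> :: ('a, 'n, 'v) picture set) \<subseteq>
            picture_topology V E closure_of cellule V E \<sigma>"
proof
  assume sub: "(cellule V E \<pi> :: ('a, 'n, 'v) picture set) \<subseteq> picture_topology V E closure_of cellule V E \<sigma>"
  let ?F = "induced_edges E B"
  have n: "CARD('n) \<ge> 2" using assms(1,2) by simp
  have \<sigma>: "partition_on V \<sigma>" and \<pi>: "partition_on V \<pi>" and ref: "\<And>A. A \<in> \<sigma> \<Longrightarrow> \<exists>C\<in>\<pi>. A \<subseteq> C"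
    using assms(4) by (auto simp: refines_def)
  have B: "B \<in> \<pi>" "B \<notin> \<sigma>" using assms(5) by auto
  have BV: "B \<subseteq> V" "B \<noteq> {}" using \<pi> B by (auto simp: partition_on_def)
  have FE: "?F \<subseteq> E" by (auto simp: induced_edges_def)
  have graph: "simple_graph B ?F"
    using assms(3) BV finite_subset by (auto simp: simple_graph_def induced_edges_def)
  interpret G: finite_config V E by (rule simple_graph_finite_config[OF assms(3)])
  interpret H: finite_config B ?F by (rule simple_graph_finite_config[OF graph])
  \<comment> \<open>A block of \<sigma> lies in some block of \<pi>, and if it meets
    \<open>B\<close>, that block is \<open>B\<close>.\<close>
  have in_B: "A \<subseteq> B" if A: "A \<in> \<sigma>" "v \<in> A" "v \<in> B" for A v
  proof -
    obtain C where "C \<in> \<pi>" "A \<subseteq> C" using ref A by blast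
    then have "C = B" using partition_on_block_unique[OF \<pi> _ B(1) _ A(3)] A(2) by blast
    then show ?thesis using \<open>A \<subseteq> C\<close> by blast
  qed
  have covered: "\<exists>A\<in>\<sigma>. v \<in> A" if "v \<in> B" for v
    using that BV \<sigma> by (auto simp: partition_on_def)
  define r where "r v = (THE A. A \<in> \<sigma> \<and> v \<in> A)" for v
  have r: "r v = A" if "A \<in> \<sigma>" "v \<in> A" for v A
    unfolding r_def
  proof (rule the_equality)
    show "A' = A" if "A' \<in> \<sigma> \<and> v \<in> A'" for A'
      using partition_on_block_unique[OF \<sigma> _ \<open>A \<in> \<sigma>\<close> _ \<open>v \<in> A\<close>] that by blast
  qed (use that in simp)
  \<comment> \<open>The partition that \<sigma> induces on \<open>B\<close>; by \<open>in_B\<close>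
    no block of \<sigma> has to be cut.\<close>
  define \<tau> where "\<tau> = {A \<in> \<sigma>. A \<subseteq> B}"
  have \<tau>: "partition_on B \<tau>"
    unfolding partition_on_def
  proof (intro conjI)
    show "\<Union>\<tau> = B" using covered in_B by (fastforce simp: \<tau>_def)
    show "disjoint \<tau>" using \<sigma> by (auto simp: \<tau>_def partition_on_def disjoint_def)
    show "{} \<notin> \<tau>" using \<sigma> by (auto simp: \<tau>_def partition_on_def)
  qed
  have r_\<tau>: "(\<exists>A\<in>\<tau>. v \<in> A \<and> w \<in> A) \<longleftrightarrow> r v = r w" if vw: "v \<in> B" "w \<in> B" for v w
  proof
    assume "\<exists>A\<in>\<tau>. v \<in> A \<and> w \<in> A"
    then show "r v = r w" using r by (auto simp: \<tau>_def)
  next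
    assume eq: "r v = r w"
    obtain A where A: "A \<in> \<sigma>" "v \<in> A" using covered[OF vw(1)] by blast
    obtain A' where A': "A' \<in> \<sigma>" "w \<in> A'" using covered[OF vw(2)] by blast
    have "A' = A" using r[OF A] r[OF A'] eq by simp
    moreover have "A \<in> \<tau>" using in_B[OF A vw(1)] A by (simp add: \<tau>_def)
    ultimately show "\<exists>A\<in>\<tau>. v \<in> A \<and> w \<in> A" using A A' by blast
  qed
  have cell_\<tau>: "cellule B ?F \<tau> = (H.cellule_of r :: ('a, 'n, 'v) picture set)"
    unfolding cellule_def H.cellule_of_def by (intro Collect_cong conj_cong ball_cong) (simp_all add: r_\<tau>)
  have cell_I: "cellule B ?F {B} = (H.cellule_of (\<lambda>_. ()) :: ('a, 'n, 'v) picture set)"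
    unfolding cellule_def H.cellule_of_def by (intro Collect_cong conj_cong ball_cong) auto
  have "cellule_dim TYPE('a ^ 'n) B ?F \<tau> \<le> cellule_dim TYPE('a ^ 'n) B ?F {B}"
    using assms(6) \<tau> by (simp add: d_heavy_def)
  then have dim: "krull_dim (H.sub_topology (H.cellule_of r :: ('a, 'n, 'v) picture set)) \<le>
      krull_dim (H.sub_topology (H.cellule_of (\<lambda>_. ()) :: ('a, 'n, 'v) picture set))"
    unfolding cellule_dim_def cell_\<tau> cell_I .
  obtain v where v: "v \<in> B" using BV by blast
  obtain A where A: "A \<in> \<sigma>" "v \<in> A" using covered[OF v] by blast
  \<comment> \<open>Here \<open>B\<close> not being a block of \<sigma> enters: the block of
    \<open>v\<close> misses a vertex \<open>w\<close> of \<open>B\<close>, so \<tau> has at least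
    two blocks.\<close>
  have "A \<noteq> B" using A(1) B(2) by metis
  then have "A \<subset> B" using in_B[OF A v] by (rule psubsetI[rotated])
  then obtain w where w: "w \<in> B" "w \<notin> A" by (blast dest: psubset_imp_ex_mem)
  obtain A' where A': "A' \<in> \<sigma>" "w \<in> A'" using covered[OF w(1)] by blast
  have rvw: "r v \<noteq> r w" using r[OF A] r[OF A'] A'(2) w(2) by metis
  from H.indiscrete_cellule_not_in_closure[OF n graph v w(1) rvw dim]
  obtain Q where Q: "Q \<in> (H.cellule_of (\<lambda>_. ()) :: ('a, 'n, 'v) picture set)" "Q \<notin> H.zero_closure (H.cellule_of r)"
    unfolding subset_iff not_all not_imp by (elim exE conjE) (rule that)
  then obtain p where p: "multihomogeneous B ?F p" "H.cellule_of r \<subseteq> zero_locus B ?F p" "Q \<notin> zero_locus B ?F p"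
    unfolding H.zero_closure_def mem_Collect_eq not_all not_imp by (elim exE conjE) (rule that)
  have mh: "multihomogeneous V E p" using multihomogeneous_superset[OF p(1) BV(1) FE] .
  note res = restrict_picture_zero_locus[OF G.finite_config_axioms H.finite_config_axioms BV(1) FE _ p(1)]
  \<comment> \<open>Read on \<open>G\<close>, the polynomial \<open>p\<close> vanishes on the
    cellule of \<sigma>, whose pictures restrict to the cellule of \<tau>, but not at an extension
    of \<open>Q\<close>.\<close>
  have "cellule V E \<sigma> \<subseteq> zero_locus V E p"
  proof
    fix P :: "('a, 'n, 'v) picture" assume P: "P \<in> cellule V E \<sigma>"
    then have PA: "P \<in> ambient_space V E" by (auto simp: cellule_def picture_space_def)
    have "restrict_picture B ?F P \<in> picture_space B ?F"
      using P restrict_picture_ambient[OF PA BV(1) FE]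
      by (auto simp: cellule_def picture_space_def restrict_picture_def induced_edges_def)
    moreover have "fst P x = fst P y \<longleftrightarrow> r x = r y" if "x \<in> B" "y \<in> B" for x y
    proof -
      have "(\<exists>A\<in>\<sigma>. x \<in> A \<and> y \<in> A) \<longleftrightarrow> (\<exists>A\<in>\<tau>. x \<in> A \<and> y \<in> A)"
        using in_B[OF _ _ that(1)] unfolding \<tau>_def by blast
      moreover have "x \<in> V" "y \<in> V" using that BV by auto
      then have "fst P x = fst P y \<longleftrightarrow> (\<exists>A\<in>\<sigma>. x \<in> A \<and> y \<in> A)"
        using P unfolding cellule_def by blast
      ultimately show ?thesis using r_\<tau>[OF that] by simp
    qed
    ultimately have "restrict_picture B ?F P \<in> H.cellule_of r"
      by (simp add: H.cellule_of_def restrict_picture_def)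
    then show "P \<in> zero_locus V E p" using res[OF PA] p(2) by blast
  qed
  then have "picture_topology V E closure_of cellule V E \<sigma> \<subseteq> picture_space V E \<inter> zero_locus V E p"
    using G.closedin_zero_locus[OF mh]
    by (intro closure_of_minimal)
      (auto simp: picture_topology_def closedin_subtopology cellule_def)
  moreover obtain P where P: "P \<in> cellule V E \<pi>" "restrict_picture B ?F P = Q"
    using ex_cellule_extension[OF n assms(3) \<pi> B(1), of Q] Q(1) cell_I by blast
  then have "P \<notin> zero_locus V E p"
    using res[of P] p(3) by (auto simp: cellule_def picture_space_def)
  ultimately show False using sub P(1) by blast
qed

end
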